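(* Let $\Delta t>0$, $u_h^{-1}=u_h^0=\Pi u_0\in V_h$ and $U^{-1}=U^0=\sqrt{F(u_0)+B}\in C^0(\Omega)$. For $n\ge0$ put $u_h^{n,*}=2u_h^n-u_h^{n-1}$ and consider the scheme: given $u_h^{n-1},u_h^n\in V_h$ and $U^{n-1},U^n\in C^0(\Omega)$, find $(u_h^{n+1},w_h^{n+1})\in V_h\times V_h$ and $U^{n+1}\in C^0(\Omega)$ such that for all $\phi,\psi\in V_h$ $$\left(\frac{3u_h^{n+1}-4u_h^n+u_h^{n-1}}{2\Delta t},\phi\right)=-A(M(u_h^{n,*});w_h^{n+1},\phi),$$ $$(w_h^{n+1},\psi)=A(\epsilon^2;u_h^{n+1},\psi)+\left(H(u_h^{n,*})U^{n+1},\psi\right),$$ $$\frac{3U^{n+1}-4U^n+U^{n-1}}{2\Delta t}=\frac12H(u_h^{n,*})\frac{3u_h^{n+1}-4u_h^n+u_h^{n-1}}{2\Delta t}\quad\text{(pointwise)}.$$ Then for any $\Delta t>0$ the scheme admits a unique solution $u_h^{n+1},w_h^{n+1}\in V_h$ and $U^{n+1}\in C^0(\Omega)$. The solution satisfies total mass conservation $\int_\Omega u_h^n\,dx=\int_\Omega u_h^0\,dx$ for any $n>0$, and, independently of the size of the time step $\Delta t$, the energy dissipation law $$\bar E^{n+1}=\bar E^n-\Delta t\,A(M(u_h^{n,*});w_h^{n+1},w_h^{n+1})-\frac14A(\epsilon^2;u_h^{n+1}-u_h^{n,*},u_h^{n+1}-u_h^{n,*})-\frac12\|U^{n+1}-U^{n,*}\|^2,$$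 where $\bar E^n=\frac12\left(E(u_h^n,U^n)+E(u_h^{n,*},U^{n,*})\right)$ and $U^{n,*}=2U^n-U^{n-1}$.
   Context: $\Omega\subset\mathbb{R}^d$ ($d=2,3$) is a bounded domain and $\epsilon>0$ is a constant. $\mathcal T$ is a quasi-uniform triangulation $\Omega=\cup_{i=1}^N T_i$, and $V_h=\{v\in C^0(\Omega)\cap H^1(\Omega): v|_{T_i}\in P_k\ \forall T_i\in\mathcal T\}$, where $P_k$ is the space of polynomials of degree at most $k$ ($k\ge1$ fixed). $C^0(\Omega)$ denotes functions continuous on $\overline\Omega$. $(\cdot,\cdot)$ and $\|\cdot\|$ are the $L^2(\Omega)$ inner product and norm. $\Pi$ is the $L^2(\Omega)$-orthogonal projection onto $V_h$. For a coefficient $a(x)$, $A(a;q,v)=\int_\Omega a(x)\nabla q\cdot\nabla v\,dx$. The potential $F$ is a $C^1$ function on an interval $I\subseteq\mathbb{R}$ (e.g. $F(u)=\frac14(u^2-1)^2$ with $I=\mathbb{R}$, or the logarithmic Flory–Huggins potential with $I=(0,1)$). The constant $B\ge0$ is such that $F+B>0$, and $H(w)=F'(w)/\sqrt{F(w)+B}$. The mobility $M\ge0$ is a continuous function. It is a standing assumption that all functions at which $F,F',H,M$ are evaluated take values (on $\overline\Omega$) where these are defined and $F+B>0$. $u_0$ is the given initial datum. The energy is $E(v,V)=\frac12A(\epsilon^2;v,v)+\int_\Omega V^2\,dx-B|\Omega|$. *)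

theory Defs
  imports "HOL-Analysis.Analysis"
begin

text \<open>
  Functions on \<open>\<Omega>\<close> are total functions on the ambient Euclidean space; only their values on
  \<open>\<Omega>\<close> or \<open>closure \<Omega>\<close> matter, and two of them are the same function when they agree there.
\<close>

definition L2 :: "'a::euclidean_space set \<Rightarrow> ('a \<Rightarrow> 'b::euclidean_space) set" where
  "L2 \<Omega> = {f \<in> borel_measurable (lebesgue_on \<Omega>). integrable (lebesgue_on \<Omega>) (\<lambda>x. (norm (f x))\<^sup>2)}"

definition L2_inner :: "'a::euclidean_space set \<Rightarrow> ('a \<Rightarrow> real) \<Rightarrow> ('a \<Rightarrow> real) \<Rightarrow> real" where
  "L2_inner \<Omega> f g = (LINT x|lebesgue_on \<Omega>. f x * g x)"

definition L2_norm :: "'a::euclidean_space set \<Rightarrow> ('a \<Rightarrow> real) \<Rightarrow> real" where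
  "L2_norm \<Omega> f = sqrt (L2_inner \<Omega> f f)"

text \<open>
  First-order weak derivatives are tested against \<open>C\<^sup>1\<close> functions with compact support in \<open>\<Omega>\<close>
  (the convention of Gilbarg and Trudinger).
\<close>

definition test_functions :: "'a::euclidean_space set \<Rightarrow> ('a \<Rightarrow> real) set" where
  "test_functions \<Omega> = {\<phi>. (\<forall>x. \<phi> differentiable (at x)) \<and>
     (\<forall>b\<in>Basis. continuous_on UNIV (\<lambda>x. frechet_derivative \<phi> (at x) b)) \<and>
     compact (closure {x. \<phi> x \<noteq> 0}) \<and> closure {x. \<phi> x \<noteq> 0} \<subseteq> \<Omega>}"

definition has_weak_gradient ::
    "'a::euclidean_space set \<Rightarrow> ('a \<Rightarrow> real) \<Rightarrow> ('a \<Rightarrow> 'a) \<Rightarrow> bool" where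
  "has_weak_gradient \<Omega> f g \<longleftrightarrow>
     (\<forall>\<phi>\<in>test_functions \<Omega>. \<forall>b\<in>Basis.
        (LINT x|lebesgue_on \<Omega>. f x * frechet_derivative \<phi> (at x) b) =
        - (LINT x|lebesgue_on \<Omega>. (g x \<bullet> b) * \<phi> x))"

definition H1 :: "'a::euclidean_space set \<Rightarrow> ('a \<Rightarrow> real) set" where
  "H1 \<Omega> = {f \<in> L2 \<Omega>. \<exists>g\<in>L2 \<Omega>. has_weak_gradient \<Omega> f g}"

text \<open>For \<open>f \<in> H1 \<Omega>\<close> with \<open>\<Omega>\<close> open this choice is unique up to null sets.\<close>

definition weak_gradient :: "'a::euclidean_space set \<Rightarrow> ('a \<Rightarrow> real) \<Rightarrow> 'a \<Rightarrow> 'a" where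
  "weak_gradient \<Omega> f = (SOME g. g \<in> L2 \<Omega> \<and> has_weak_gradient \<Omega> f g)"

definition A_form ::
    "'a::euclidean_space set \<Rightarrow> ('a \<Rightarrow> real) \<Rightarrow> ('a \<Rightarrow> real) \<Rightarrow> ('a \<Rightarrow> real) \<Rightarrow> real" where
  "A_form \<Omega> a q v = (LINT x|lebesgue_on \<Omega>. a x * (weak_gradient \<Omega> q x \<bullet> weak_gradient \<Omega> v x))"

definition C0 :: "'a::euclidean_space set \<Rightarrow> ('a \<Rightarrow> real) set" where
  "C0 \<Omega> = {v. continuous_on (closure \<Omega>) v}"

text \<open>
  Quasi-uniformity of a family of meshes asks for one \<open>\<sigma> > 0\<close>, the same for the whole family,
  such that each cell contains a ball of radius \<open>\<sigma>\<close> times the mesh size.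
  The conformity condition is part of \<^const>\<open>triangulation\<close>; its cells are closed, so they
  cover the closure of \<open>\<Omega>\<close>.
\<close>

definition mesh_size :: "'a::euclidean_space set set \<Rightarrow> real" where
  "mesh_size \<T> = Max (diameter ` \<T>)"

definition quasi_uniform_triangulation ::
    "real \<Rightarrow> 'a::euclidean_space set \<Rightarrow> 'a set set \<Rightarrow> bool" where
  "quasi_uniform_triangulation \<sigma> \<Omega> \<T> \<longleftrightarrow>
     triangulation \<T> \<and> (\<forall>T\<in>\<T>. int DIM('a) simplex T) \<and> \<Union>\<T> = closure \<Omega> \<and>
     (\<forall>T\<in>\<T>. \<exists>c. ball c (\<sigma> * mesh_size \<T>) \<subseteq> T)"

text \<open>Multi-indices are the functions \<open>\<alpha>\<close> from the standard basis to the naturals.\<close>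

definition poly_space :: "nat \<Rightarrow> ('a::euclidean_space \<Rightarrow> real) set" where
  "poly_space k = {p. \<exists>c. p = (\<lambda>x. \<Sum>\<alpha> \<in> {\<alpha> \<in> Basis \<rightarrow>\<^sub>E {..k}. (\<Sum>b\<in>Basis. \<alpha> b) \<le> k}.
                              c \<alpha> * (\<Prod>b\<in>Basis. (x \<bullet> b) ^ \<alpha> b))}"

definition fe_space :: "'a::euclidean_space set \<Rightarrow> 'a set set \<Rightarrow> nat \<Rightarrow> ('a \<Rightarrow> real) set" where
  "fe_space \<Omega> \<T> k = {v \<in> C0 \<Omega> \<inter> H1 \<Omega>. \<forall>T\<in>\<T>. \<exists>p\<in>poly_space k. \<forall>x\<in>T. v x = p x}"

definition L2_proj ::
    "'a::euclidean_space set \<Rightarrow> ('a \<Rightarrow> real) set \<Rightarrow> ('a \<Rightarrow> real) \<Rightarrow> 'a \<Rightarrow> real" where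
  "L2_proj \<Omega> V f = (SOME v. v \<in> V \<and> (\<forall>\<phi>\<in>V. L2_inner \<Omega> (\<lambda>x. f x - v x) \<phi> = 0))"

text \<open>
  The potential is given by \<open>F\<close> and its derivative \<open>F'\<close> on the interval \<open>I\<close>, the mobility lives
  on a set \<open>J\<close>. The functions \<open>F\<close>, \<open>F'\<close>, \<open>H\<close>, \<open>M\<close> are all meaningful exactly on the
  following set of values.
\<close>

definition admissible_values :: "real set \<Rightarrow> real set \<Rightarrow> (real \<Rightarrow> real) \<Rightarrow> real \<Rightarrow> real set" where
  "admissible_values I J F B = {s \<in> I \<inter> J. F s + B > 0}"

definition H_fun :: "(real \<Rightarrow> real) \<Rightarrow> (real \<Rightarrow> real) \<Rightarrow> real \<Rightarrow> real \<Rightarrow> real" where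
  "H_fun F F' B s = F' s / sqrt (F s + B)"

definition extrap :: "('a \<Rightarrow> real) \<Rightarrow> ('a \<Rightarrow> real) \<Rightarrow> 'a \<Rightarrow> real" where
  "extrap v\<^sub>o v = (\<lambda>x. 2 * v x - v\<^sub>o x)"

definition bdf2 :: "real \<Rightarrow> ('a \<Rightarrow> real) \<Rightarrow> ('a \<Rightarrow> real) \<Rightarrow> ('a \<Rightarrow> real) \<Rightarrow> 'a \<Rightarrow> real" where
  "bdf2 \<Delta>t v\<^sub>o v v\<^sub>n = (\<lambda>x. (3 * v\<^sub>n x - 4 * v x + v\<^sub>o x) / (2 * \<Delta>t))"

text \<open>
  One step: the subscript \<open>o\<close> stands for level \<open>n - 1\<close>, no subscript for level \<open>n\<close>, and the
  subscript \<open>n\<close> (new) for level \<open>n + 1\<close>.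
\<close>

definition scheme_step ::
    "'a::euclidean_space set \<Rightarrow> ('a \<Rightarrow> real) set \<Rightarrow> real \<Rightarrow> real \<Rightarrow> (real \<Rightarrow> real) \<Rightarrow> (real \<Rightarrow> real) \<Rightarrow>
     ('a \<Rightarrow> real) \<Rightarrow> ('a \<Rightarrow> real) \<Rightarrow> ('a \<Rightarrow> real) \<Rightarrow> ('a \<Rightarrow> real) \<Rightarrow>
     ('a \<Rightarrow> real) \<Rightarrow> ('a \<Rightarrow> real) \<Rightarrow> ('a \<Rightarrow> real) \<Rightarrow> bool" where
  "scheme_step \<Omega> V \<epsilon> \<Delta>t H M u\<^sub>o u U\<^sub>o U u\<^sub>n w\<^sub>n U\<^sub>n \<longleftrightarrow>
     u\<^sub>n \<in> V \<and> w\<^sub>n \<in> V \<and> U\<^sub>n \<in> C0 \<Omega> \<and>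
     (\<forall>\<phi>\<in>V. L2_inner \<Omega> (bdf2 \<Delta>t u\<^sub>o u u\<^sub>n) \<phi> = - A_form \<Omega> (\<lambda>x. M (extrap u\<^sub>o u x)) w\<^sub>n \<phi>) \<and>
     (\<forall>\<psi>\<in>V. L2_inner \<Omega> w\<^sub>n \<psi> =
        A_form \<Omega> (\<lambda>_. \<epsilon>\<^sup>2) u\<^sub>n \<psi> + L2_inner \<Omega> (\<lambda>x. H (extrap u\<^sub>o u x) * U\<^sub>n x) \<psi>) \<and>
     (\<forall>x\<in>closure \<Omega>. bdf2 \<Delta>t U\<^sub>o U U\<^sub>n x = 1/2 * H (extrap u\<^sub>o u x) * bdf2 \<Delta>t u\<^sub>o u u\<^sub>n x)"

definition energy ::
    "'a::euclidean_space set \<Rightarrow> real \<Rightarrow> real \<Rightarrow> ('a \<Rightarrow> real) \<Rightarrow> ('a \<Rightarrow> real) \<Rightarrow> real" where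
  "energy \<Omega> \<epsilon> B v V =
     1/2 * A_form \<Omega> (\<lambda>_. \<epsilon>\<^sup>2) v v + (LINT x|lebesgue_on \<Omega>. (V x)\<^sup>2) - B * measure lebesgue \<Omega>"

definition mean_energy ::
    "'a::euclidean_space set \<Rightarrow> real \<Rightarrow> real \<Rightarrow> (int \<Rightarrow> 'a \<Rightarrow> real) \<Rightarrow> (int \<Rightarrow> 'a \<Rightarrow> real) \<Rightarrow>
     int \<Rightarrow> real" where
  "mean_energy \<Omega> \<epsilon> B u U n =
     1/2 * (energy \<Omega> \<epsilon> B (u n) (U n)
            + energy \<Omega> \<epsilon> B (extrap (u (n - 1)) (u n)) (extrap (U (n - 1)) (U n)))"

end

theory Submission
  imports Defs "HOL-Real_Asymp.Real_Asymp"
begin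

text \<open>
  Eliminating the new \<open>U\<close> with the third, pointwise equation turns one step of the scheme into a
  linear problem for the pair \<open>(u, w)\<close> in the finite element space \<open>V\<close>: find \<open>u\<close> and \<open>w\<close> with
  \<open>m u \<phi> + d w \<phi> = f \<phi>\<close> and \<open>m w \<psi> - a u \<psi> = g \<psi>\<close> for all \<open>\<phi>\<close> and \<open>\<psi>\<close> in \<open>V\<close>
  (\<open>scheme_step_iff_saddle\<close>). Here \<open>m\<close> is the \<open>L\<^sup>2\<close> inner product, \<open>d\<close> is the mobility form times
  \<open>2 \<Delta>t / 3\<close>, and \<open>a\<close> is the gradient form plus \<open>1/2 (H\<^sup>2 u, \<psi>)\<close>; all three are symmetric and
  positive semidefinite. The homogeneous problem has only the zero solution: tested with \<open>w\<close> and
  \<open>u\<close> it gives \<open>a u u + d w w = 0\<close>, so by Cauchy-Schwarz the coupling terms drop out and \<open>m\<close>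
  forces \<open>u = w = 0\<close>, even where the mobility degenerates (\<open>saddle_unique\<close>). Because \<open>V\<close> is finite
  dimensional (\<open>fe_space_finite_span\<close>) and the problem is self-adjoint up to exchanging the two
  test functions, uniqueness gives existence (\<open>saddle_exists\<close>, from the double annihilator
  property \<open>double_annihilator\<close>).

  Mass is conserved because the constant \<open>1\<close> lies in \<open>V\<close> and has weak gradient zero
  (\<open>A_form_const\<close>): it annihilates the right-hand side of the first equation, so the masses obey
  \<open>3 m\<^sub>n\<^sub>+\<^sub>1 = 4 m\<^sub>n - m\<^sub>n\<^sub>-\<^sub>1\<close>, and the first two are equal. The energy law comes from testing with
  \<open>w\<close> and with the difference quotient of \<open>u\<close>; the nonlinear term becomes the product of \<open>U\<close>
  and its own difference quotient, and the G-stability identity \<open>bdf2_identity\<close> writes both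
  resulting products as differences of the averaged energies plus squares
  (\<open>scheme_step_energy\<close>).

  The forms are bilinear only if the chosen weak gradients depend linearly on the function almost
  everywhere. That is uniqueness of weak gradients, which rests on the fundamental lemma of the
  calculus of variations for \<open>C\<^sup>1\<close> test functions (\<open>fundamental_lemma\<close>). Functions are identified
  when they agree on \<open>closure \<Omega>\<close>; this identification is built into the notion of linearity used
  for the forms (\<open>lin_on\<close>).
\<close>

section \<open>Subspaces of finite coordinate spaces\<close>

text \<open>
  A subspace of a finite-dimensional coordinate space is its own double annihilator. This is the
  Fredholm alternative in a form without bases or dimensions: a linear system is solvable as soon
  as every linear relation between its left-hand sides also holds between its right-hand sides.
  The induction removes one coordinate \<open>a\<close>, replacing the subspace by its hyperplane \<open>s a = 0\<close>
  and the target by its translate along a vector \<open>s0\<close> of the subspace with \<open>s0 a = 1\<close>.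
\<close>

lemma double_annihilator:
  fixes S :: "('j \<Rightarrow> real) set"
  assumes "finite J" and "S \<noteq> {}"
    and "\<And>p q c. p \<in> S \<Longrightarrow> q \<in> S \<Longrightarrow> (\<lambda>j. p j + c * q j) \<in> S"
    and "\<And>y. (\<forall>s\<in>S. (\<Sum>j\<in>J. y j * s j) = 0) \<Longrightarrow> (\<Sum>j\<in>J. y j * l j) = 0"
  shows "\<exists>s\<in>S. \<forall>j\<in>J. s j = l j"
  using assms
proof (induction J arbitrary: S l rule: finite_induct)
  case empty
  then show ?case by auto
next
  case (insert a J)
  note closed = insert.prems(2) and ann = insert.prems(3)
  show ?case
  proof (cases "\<forall>s\<in>S. s a = 0")
    case True
    have "\<exists>s\<in>S. \<forall>j\<in>J. s j = l j"
    proof (rule insert.IH[OF insert.prems(1) closed])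
      fix y :: "'j \<Rightarrow> real" assume y: "\<forall>s\<in>S. (\<Sum>j\<in>J. y j * s j) = 0"
      have upd: "(\<Sum>j\<in>J. (y(a := 0)) j * s j) = (\<Sum>j\<in>J. y j * s j)" for s :: "'j \<Rightarrow> real"
        using insert.hyps by (intro sum.cong) auto
      have "(\<Sum>j\<in>insert a J. (y(a := 0)) j * l j) = 0"
        by (rule ann) (use y upd insert.hyps in simp)
      then show "(\<Sum>j\<in>J. y j * l j) = 0"
        using upd insert.hyps by simp
    qed
    moreover have pick: "(\<Sum>j\<in>insert a J. (if j = a then 1 else 0) * s j) = s a" for s :: "'j \<Rightarrow> real"
    proof -
      have "(\<Sum>j\<in>J. (if j = a then 1 else 0) * s j) = 0"
        using insert.hyps by (intro sum.neutral) auto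
      then show ?thesis using insert.hyps by simp
    qed
    have "l a = 0"
      using ann[of "\<lambda>j. if j = a then 1 else 0"] True unfolding pick by simp
    ultimately show ?thesis using True by auto
  next
    case False
    then obtain s1 where s1: "s1 \<in> S" "s1 a \<noteq> 0" by auto
    have zero: "(\<lambda>j. 0) \<in> S" using closed[OF s1(1) s1(1), of "-1"] by simp
    define s0 where "s0 = (\<lambda>j. s1 j / s1 a)"
    have s0: "s0 \<in> S" "s0 a = 1"
      using closed[OF zero s1(1), of "1 / s1 a"] s1(2) by (simp_all add: s0_def)
    define S0 where "S0 = {s \<in> S. s a = 0}"
    have "\<exists>s\<in>S0. \<forall>j\<in>J. s j = l j - l a * s0 j"
    proof (rule insert.IH)
      show "S0 \<noteq> {}" using zero by (auto simp: S0_def)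
      show "\<And>p q c. p \<in> S0 \<Longrightarrow> q \<in> S0 \<Longrightarrow> (\<lambda>j. p j + c * q j) \<in> S0"
        using closed by (auto simp: S0_def)
      fix y :: "'j \<Rightarrow> real" assume y: "\<forall>s\<in>S0. (\<Sum>j\<in>J. y j * s j) = 0"
      \<comment> \<open>A relation on the hyperplane extends uniquely to the whole subspace by its value at \<open>s0\<close>.\<close>
      define y' where "y' = y(a := - (\<Sum>j\<in>J. y j * s0 j))"
      have split: "(\<Sum>j\<in>insert a J. y' j * s j)
          = (\<Sum>j\<in>J. y j * s j) - (\<Sum>j\<in>J. y j * s0 j) * s a" for s :: "'j \<Rightarrow> real"
      proof -
        have "(\<Sum>j\<in>J. y' j * s j) = (\<Sum>j\<in>J. y j * s j)"
          using insert.hyps by (intro sum.cong) (auto simp: y'_def)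
        then show ?thesis using insert.hyps by (simp add: y'_def)
      qed
      have shift: "(\<Sum>j\<in>J. y j * (s j - s a * s0 j))
          = (\<Sum>j\<in>J. y j * s j) - (\<Sum>j\<in>J. y j * s0 j) * s a" for s :: "'j \<Rightarrow> real"
        by (simp add: right_diff_distrib sum_subtractf sum_distrib_left sum_distrib_right ac_simps)
      have "(\<Sum>j\<in>insert a J. y' j * l j) = 0"
      proof (rule ann, intro ballI)
        fix s assume "s \<in> S"
        then have "(\<lambda>j. s j - s a * s0 j) \<in> S0"
          using closed[OF _ s0(1), of s "- s a"] s0(2) by (simp add: S0_def)
        then show "(\<Sum>j\<in>insert a J. y' j * s j) = 0"
          using y unfolding split shift[symmetric] by (drule_tac bspec) simp_all
      qed
      then show "(\<Sum>j\<in>J. y j * (l j - l a * s0 j)) = 0"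
        by (simp only: split shift)
    qed
    then obtain s where s: "s \<in> S" "s a = 0" "\<forall>j\<in>J. s j = l j - l a * s0 j"
      by (auto simp: S0_def)
    have "(\<lambda>j. s j + l a * s0 j) \<in> S" using closed s(1) s0(1) by blast
    then show ?thesis
      by (rule bexI[rotated]) (use s s0 in auto)
  qed
qed

text \<open>
  The same elimination of one coordinate at a time: the spanning set found for the hyperplane
  \<open>s a = 0\<close> needs at most one more vector.
\<close>

lemma finite_spanning_subset:
  fixes S :: "('j \<Rightarrow> real) set"
  assumes "finite J"
    and "\<And>p q c. p \<in> S \<Longrightarrow> q \<in> S \<Longrightarrow> (\<lambda>j. p j + c * q j) \<in> S"
  shows "\<exists>P. finite P \<and> P \<subseteq> S \<and> (\<forall>s\<in>S. \<exists>c. \<forall>j\<in>J. s j = (\<Sum>p\<in>P. c p * p j))"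
  using assms
proof (induction J arbitrary: S rule: finite_induct)
  case empty
  then show ?case by auto
next
  case (insert a J)
  note closed = insert.prems
  define S0 where "S0 = {s \<in> S. s a = 0}"
  have "\<exists>P. finite P \<and> P \<subseteq> S0 \<and> (\<forall>s\<in>S0. \<exists>c. \<forall>j\<in>J. s j = (\<Sum>p\<in>P. c p * p j))"
    by (rule insert.IH) (use closed in \<open>auto simp: S0_def\<close>)
  then obtain P where P: "finite P" "P \<subseteq> S0"
    "\<And>s. s \<in> S0 \<Longrightarrow> \<exists>c. \<forall>j\<in>J. s j = (\<Sum>p\<in>P. c p * p j)" by blast
  have van: "(\<Sum>p\<in>P. c p * p a) = 0" for c
    using P(2) by (intro sum.neutral) (auto simp: S0_def)
  show ?case
  proof (cases "S = S0")
    case True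
    have "\<forall>s\<in>S. \<exists>c. \<forall>j\<in>insert a J. s j = (\<Sum>p\<in>P. c p * p j)"
    proof
      fix s assume "s \<in> S"
      then have s: "s \<in> S0" using True by simp
      then obtain c where "\<forall>j\<in>J. s j = (\<Sum>p\<in>P. c p * p j)" using P(3) by blast
      then show "\<exists>c. \<forall>j\<in>insert a J. s j = (\<Sum>p\<in>P. c p * p j)"
        using s van by (auto simp: S0_def)
    qed
    then show ?thesis using P True by blast
  next
    case False
    then obtain s0 where s0: "s0 \<in> S" "s0 a \<noteq> 0" by (auto simp: S0_def)
    have "s0 \<notin> P" using P(2) s0(2) by (auto simp: S0_def)
    have "\<forall>s\<in>S. \<exists>c. \<forall>j\<in>insert a J. s j = (\<Sum>p\<in>insert s0 P. c p * p j)"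
    proof
      fix s assume s: "s \<in> S"
      define t where "t = s a / s0 a"
      have "(\<lambda>j. s j - t * s0 j) \<in> S0"
        using closed[OF s s0(1), of "-t"] s0(2) by (simp add: S0_def t_def)
      then obtain c where c: "\<forall>j\<in>J. s j - t * s0 j = (\<Sum>p\<in>P. c p * p j)"
        using P(3) by blast
      have "(\<Sum>p\<in>insert s0 P. (c(s0 := t)) p * p j) = t * s0 j + (\<Sum>p\<in>P. c p * p j)" for j
      proof -
        have "(\<Sum>p\<in>P. (c(s0 := t)) p * p j) = (\<Sum>p\<in>P. c p * p j)"
          using \<open>s0 \<notin> P\<close> by (intro sum.cong) auto
        then show ?thesis using P(1) \<open>s0 \<notin> P\<close> by simp
      qed
      then have "\<forall>j\<in>insert a J. s j = (\<Sum>p\<in>insert s0 P. (c(s0 := t)) p * p j)"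
        using c van[of c] s0(2) by (auto simp: t_def algebra_simps)
      then show "\<exists>c. \<forall>j\<in>insert a J. s j = (\<Sum>p\<in>insert s0 P. c p * p j)" by blast
    qed
    moreover have "insert s0 P \<subseteq> S" using P(2) s0(1) by (auto simp: S0_def)
    ultimately show ?thesis using P(1) by blast
  qed
qed

section \<open>Positive semidefinite forms and a symmetric saddle-point problem\<close>

text \<open>
  Functions matter only through their values on \<open>K\<close>. Stating linearity for every \<open>z\<close> that equals
  the combination on \<open>K\<close>, and not just for the combination itself, makes invariance under
  changes off \<open>K\<close> a part of linearity, so that no quotient space is needed.
\<close>

definition lin_on :: "'a set \<Rightarrow> ('a \<Rightarrow> real) set \<Rightarrow> (('a \<Rightarrow> real) \<Rightarrow> real) \<Rightarrow> bool" where
  "lin_on K V f \<longleftrightarrow> (\<forall>q\<in>V. \<forall>v\<in>V. \<forall>z\<in>V. \<forall>c.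
     (\<forall>x\<in>K. z x = q x + c * v x) \<longrightarrow> f z = f q + c * f v)"

definition psd_form ::
    "'a set \<Rightarrow> ('a \<Rightarrow> real) set \<Rightarrow> (('a \<Rightarrow> real) \<Rightarrow> ('a \<Rightarrow> real) \<Rightarrow> real) \<Rightarrow> bool" where
  "psd_form K V b \<longleftrightarrow> (\<forall>v\<in>V. lin_on K V (b v) \<and> b v v \<ge> 0 \<and> (\<forall>q\<in>V. b v q = b q v))"

definition fun_space :: "('a \<Rightarrow> real) set \<Rightarrow> bool" where
  "fun_space V \<longleftrightarrow> (\<lambda>x. 0) \<in> V \<and> (\<forall>q\<in>V. \<forall>v\<in>V. \<forall>c. (\<lambda>x. q x + c * v x) \<in> V)"

lemma fun_space_comb: "fun_space V \<Longrightarrow> q \<in> V \<Longrightarrow> v \<in> V \<Longrightarrow> (\<lambda>x. q x + c * v x) \<in> V"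
  by (simp add: fun_space_def)

lemma fun_space_comb3:
  assumes V: "fun_space V" and "p \<in> V" "q \<in> V" "r \<in> V"
  shows "(\<lambda>x. \<alpha> * p x + \<beta> * q x + \<gamma> * r x) \<in> V"
proof -
  have "(\<lambda>x. ((0 + \<alpha> * p x) + \<beta> * q x) + \<gamma> * r x) \<in> V"
    by (intro fun_space_comb[OF V] assms(2-4)) (use V in \<open>simp add: fun_space_def\<close>)
  then show ?thesis by simp
qed

lemma fun_space_sum:
  assumes "fun_space V" "finite P" "\<And>i. i \<in> P \<Longrightarrow> e i \<in> V"
  shows "(\<lambda>x. \<Sum>i\<in>P. c i * e i x) \<in> V"
  using assms(2,3)
proof (induction P rule: finite_induct)
  case empty
  then show ?case using assms(1) by (simp add: fun_space_def)
next
  case (insert i P)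
  then have "(\<lambda>x. (\<Sum>i\<in>P. c i * e i x) + c i * e i x) \<in> V"
    using assms(1) by (simp add: fun_space_def)
  then show ?case using insert.hyps by (simp add: add.commute)
qed

lemma lin_onD:
  "lin_on K V f \<Longrightarrow> q \<in> V \<Longrightarrow> v \<in> V \<Longrightarrow> z \<in> V \<Longrightarrow> (\<And>x. x \<in> K \<Longrightarrow> z x = q x + c * v x)
    \<Longrightarrow> f z = f q + c * f v"
  unfolding lin_on_def by blast

lemma lin_on_cong:
  "lin_on K V f \<Longrightarrow> q \<in> V \<Longrightarrow> z \<in> V \<Longrightarrow> (\<And>x. x \<in> K \<Longrightarrow> z x = q x) \<Longrightarrow> f z = f q"
  using lin_onD[of K V f q q z 0] by simp

lemma lin_on_zero:
  "lin_on K V f \<Longrightarrow> z \<in> V \<Longrightarrow> (\<And>x. x \<in> K \<Longrightarrow> z x = 0) \<Longrightarrow> f z = 0"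
  using lin_onD[of K V f z z z 1] by simp

lemma lin_on_sum:
  assumes f: "lin_on K V f" and V: "fun_space V" and P: "finite P" "\<And>i. i \<in> P \<Longrightarrow> e i \<in> V"
  shows "f (\<lambda>x. \<Sum>i\<in>P. c i * e i x) = (\<Sum>i\<in>P. c i * f (e i))"
  using P
proof (induction P rule: finite_induct)
  case empty
  have "(\<lambda>x. 0) \<in> V" using V by (simp add: fun_space_def)
  then show ?case using lin_on_zero[OF f, of "\<lambda>x. 0"] by simp
next
  case (insert i P)
  have "f (\<lambda>x. \<Sum>i\<in>insert i P. c i * e i x) = f (\<lambda>x. \<Sum>i\<in>P. c i * e i x) + c i * f (e i)"
    using insert.hyps insert.prems
    by (intro lin_onD[OF f] fun_space_sum[OF V]) auto
  then show ?case using insert by simp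
qed

lemma psd_form_D:
  assumes "psd_form K V b" "v \<in> V"
  shows "lin_on K V (b v)" "b v v \<ge> 0" "q \<in> V \<Longrightarrow> b v q = b q v"
  using assms unfolding psd_form_def by auto

lemma psd_form_comb_left:
  assumes b: "psd_form K V b" and "q \<in> V" "v \<in> V" "z \<in> V" "y \<in> V"
    and "\<And>x. x \<in> K \<Longrightarrow> z x = q x + c * v x"
  shows "b z y = b q y + c * b v y"
  using lin_onD[OF psd_form_D(1)[OF b \<open>y \<in> V\<close>] assms(2-4), of c] assms(6)
    psd_form_D(3)[OF b \<open>y \<in> V\<close>] assms(2-4) by simp

lemma psd_form_comb3:
  assumes V: "fun_space V" and b: "psd_form K V b" and "p \<in> V" "q \<in> V" "r \<in> V" "z \<in> V" "y \<in> V"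
    and z: "\<And>x. x \<in> K \<Longrightarrow> z x = \<alpha> * p x + \<beta> * q x + \<gamma> * r x"
  shows "b z y = \<alpha> * b p y + \<beta> * b q y + \<gamma> * b r y"
proof -
  have zero: "(\<lambda>x. 0) \<in> V" using V by (simp add: fun_space_def)
  define z1 where "z1 = (\<lambda>x. 0 + \<alpha> * p x)"
  define z2 where "z2 = (\<lambda>x. z1 x + \<beta> * q x)"
  have in_V: "z1 \<in> V" "z2 \<in> V"
    unfolding z1_def z2_def by (intro fun_space_comb[OF V] zero assms(3,4))+
  have "b z y = b z2 y + \<gamma> * b r y" "b z2 y = b z1 y + \<beta> * b q y" "b z1 y = b (\<lambda>x. 0) y + \<alpha> * b p y"
    by (rule psd_form_comb_left[OF b]; use assms in_V zero in \<open>simp add: z1_def z2_def\<close>)+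
  moreover have "b (\<lambda>x. 0) y = 0"
    using lin_on_zero[OF psd_form_D(1)[OF b \<open>y \<in> V\<close>] zero] psd_form_D(3)[OF b \<open>y \<in> V\<close> zero] by simp
  ultimately show ?thesis by simp
qed

lemma psd_form_add:
  assumes "psd_form K V a" "psd_form K V b" "t \<ge> 0"
  shows "psd_form K V (\<lambda>q v. a q v + t * b q v)"
  unfolding psd_form_def
proof (intro ballI conjI)
  fix q assume q: "q \<in> V"
  show "lin_on K V (\<lambda>v. a q v + t * b q v)"
    unfolding lin_on_def
  proof (intro ballI allI impI)
    fix p v z c assume *: "p \<in> V" "v \<in> V" "z \<in> V" "\<forall>x\<in>K. z x = p x + c * v x"
    have "a q z = a q p + c * a q v" "b q z = b q p + c * b q v"
      using lin_onD[OF psd_form_D(1)[OF assms(1) q] *(1-3), of c]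
        lin_onD[OF psd_form_D(1)[OF assms(2) q] *(1-3), of c] *(4) by simp_all
    then show "a q z + t * b q z = a q p + t * b q p + c * (a q v + t * b q v)"
      by (simp add: algebra_simps)
  qed
  show "a q q + t * b q q \<ge> 0"
    using psd_form_D(2)[OF assms(1) q] psd_form_D(2)[OF assms(2) q] assms(3) by simp
  show "a q v + t * b q v = a v q + t * b v q" if "v \<in> V" for v
    using psd_form_D(3)[OF assms(1) q that] psd_form_D(3)[OF assms(2) q that] by simp
qed

lemma psd_form_zero: "psd_form K V (\<lambda>q v. 0)"
  by (simp add: psd_form_def lin_on_def)

text \<open>
  The degenerate case of the Cauchy-Schwarz inequality. Otherwise \<open>b (q + t v) (q + t v)\<close>
  would be a non-constant affine function of \<open>t\<close>, hence negative somewhere.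
\<close>

lemma psd_form_null:
  assumes b: "psd_form K V b" and V: "fun_space V" and v: "v \<in> V" "b v v = 0" and q: "q \<in> V"
  shows "b q v = 0"
proof -
  have expand: "b q q + 2 * t * b q v \<ge> 0" for t
  proof -
    define z where "z = (\<lambda>x. q x + t * v x)"
    have z: "z \<in> V" using V q v(1) by (simp add: z_def fun_space_def)
    have "b z z = b z q + t * b z v" "b q z = b q q + t * b q v" "b v z = b v q + t * b v v"
      by (rule lin_onD[OF psd_form_D(1)[OF b]]; use q v z in \<open>simp add: z_def\<close>)+
    moreover have "b z q = b q z" "b z v = b v z" "b v q = b q v"
      using psd_form_D(3)[OF b] z q v(1) by blast+
    ultimately have "b z z = b q q + 2 * t * b q v" using v(2) by simp
    then show ?thesis using psd_form_D(2)[OF b z] by simp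
  qed
  show ?thesis
  proof (rule ccontr)
    assume ne: "b q v \<noteq> 0"
    have "b q q + 2 * (- (b q q + 1) / (2 * b q v)) * b q v = -1"
      using ne by (simp add: field_simps)
    then show False using expand[of "- (b q q + 1) / (2 * b q v)"] by simp
  qed
qed

text \<open>
  Testing the first equation with \<open>w\<close> and the second with \<open>u\<close> gives \<open>a u u + d w w = 0\<close>, so both
  terms vanish. By Cauchy-Schwarz the coupling terms \<open>d w\<close> and \<open>a u\<close> then vanish identically, and
  what is left is \<open>m u = 0\<close> and \<open>m w = 0\<close>.
\<close>

lemma saddle_unique:
  assumes V: "fun_space V" and m: "psd_form K V m" and a: "psd_form K V a" and d: "psd_form K V d"
    and def: "\<And>v. v \<in> V \<Longrightarrow> m v v = 0 \<Longrightarrow> \<forall>x\<in>K. v x = 0"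
    and uw: "u \<in> V" "w \<in> V"
    and eq1: "\<And>\<phi>. \<phi> \<in> V \<Longrightarrow> m u \<phi> + d w \<phi> = 0"
    and eq2: "\<And>\<psi>. \<psi> \<in> V \<Longrightarrow> m w \<psi> = a u \<psi>"
  shows "\<forall>x\<in>K. u x = 0 \<and> w x = 0"
proof -
  have "a u u + d w w = 0"
    using eq1[OF uw(2)] eq2[OF uw(1)] psd_form_D(3)[OF m uw(2) uw(1)] by simp
  then have nul: "a u u = 0" "d w w = 0"
    using psd_form_D(2)[OF a uw(1)] psd_form_D(2)[OF d uw(2)] by auto
  have "d w u = 0" "a u w = 0"
    using psd_form_null[OF d V uw(2) nul(2) uw(1)] psd_form_null[OF a V uw(1) nul(1) uw(2)]
      psd_form_D(3)[OF d uw(2,1)] psd_form_D(3)[OF a uw(1,2)] by simp_all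
  then have "m u u = 0" "m w w = 0"
    using eq1[OF uw(1)] eq2[OF uw(2)] by auto
  then show ?thesis using def uw by blast
qed

text \<open>
  With test functions from a finite spanning family the problem is a square linear system, up to
  redundant equations, and \<open>double_annihilator\<close> applies. Since all three forms are symmetric, a
  relation between the rows with coefficient functions \<open>\<phi>\<close> and \<open>\<psi>\<close> says that \<open>(\<psi>, \<phi>)\<close> solves the
  homogeneous problem itself, so \<open>saddle_unique\<close> settles solvability as well as uniqueness.
\<close>

lemma saddle_exists:
  fixes e :: "'i \<Rightarrow> 'a \<Rightarrow> real"
  assumes V: "fun_space V" and m: "psd_form K V m" and a: "psd_form K V a" and d: "psd_form K V d"
    and def: "\<And>v. v \<in> V \<Longrightarrow> m v v = 0 \<Longrightarrow> \<forall>x\<in>K. v x = 0"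
    and P: "finite P" "\<And>i. e i \<in> V"
    and span: "\<And>v. v \<in> V \<Longrightarrow> \<exists>c. \<forall>x\<in>K. v x = (\<Sum>i\<in>P. c i * e i x)"
    and f: "lin_on K V f" and g: "lin_on K V g"
  shows "\<exists>u\<in>V. \<exists>w\<in>V. \<forall>\<phi>\<in>V. m u \<phi> + d w \<phi> = f \<phi> \<and> m w \<phi> - a u \<phi> = g \<phi>"
proof -
  define row where "row = (\<lambda>u w. case_sum (\<lambda>i. m u (e i) + d w (e i)) (\<lambda>i. m w (e i) - a u (e i)))"
  define S where "S = {row u w |u w. u \<in> V \<and> w \<in> V}"
  have zero: "(\<lambda>x. 0) \<in> V" using V by (simp add: fun_space_def)
  have comb: "b (\<lambda>x. q x + c * v x) y = b q y + c * b v y"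
    if "psd_form K V b" "q \<in> V" "v \<in> V" "y \<in> V" for b q v y c
    by (rule psd_form_comb_left[OF that(1-3) _ that(4)])
      (use V that in \<open>simp_all add: fun_space_def\<close>)
  have b0: "b (\<lambda>x. 0) z = 0" "b z (\<lambda>x. 0) = 0" if "psd_form K V b" "z \<in> V" for b z
    using lin_on_zero[OF psd_form_D(1)[OF that] zero] psd_form_D(3)[OF that zero] by simp_all
  have "\<exists>s\<in>S. \<forall>j\<in>P <+> P. s j = case_sum (\<lambda>i. f (e i)) (\<lambda>i. g (e i)) j"
  proof (rule double_annihilator)
    show "finite (P <+> P)" using P(1) by simp
    show "S \<noteq> {}" using zero by (auto simp: S_def)
    fix p q :: "'i + 'i \<Rightarrow> real" and c :: real
    assume "p \<in> S" "q \<in> S"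
    then obtain u w u' w' where uw: "u \<in> V" "w \<in> V" "u' \<in> V" "w' \<in> V" "p = row u w" "q = row u' w'"
      by (auto simp: S_def)
    have cl: "(\<lambda>x. u x + c * u' x) \<in> V" "(\<lambda>x. w x + c * w' x) \<in> V"
      using V uw by (simp_all add: fun_space_def)
    have "p j + c * q j = row (\<lambda>x. u x + c * u' x) (\<lambda>x. w x + c * w' x) j" for j
      by (cases j) (simp_all add: row_def uw P comb[OF m] comb[OF a] comb[OF d] algebra_simps)
    then have "(\<lambda>j. p j + c * q j) = row (\<lambda>x. u x + c * u' x) (\<lambda>x. w x + c * w' x)" by blast
    then show "(\<lambda>j. p j + c * q j) \<in> S" using cl by (auto simp: S_def)
  next
    fix y :: "'i + 'i \<Rightarrow> real"
    assume y: "\<forall>s\<in>S. (\<Sum>j\<in>P <+> P. y j * s j) = 0"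
    define \<phi> where "\<phi> = (\<lambda>x. \<Sum>i\<in>P. y (Inl i) * e i x)"
    define \<psi> where "\<psi> = (\<lambda>x. \<Sum>i\<in>P. y (Inr i) * e i x)"
    have V': "\<phi> \<in> V" "\<psi> \<in> V"
      unfolding \<phi>_def \<psi>_def using fun_space_sum[OF V P] by auto
    have sums: "h \<phi> = (\<Sum>i\<in>P. y (Inl i) * h (e i))" "h \<psi> = (\<Sum>i\<in>P. y (Inr i) * h (e i))"
      if "lin_on K V h" for h
      unfolding \<phi>_def \<psi>_def using lin_on_sum[OF that V P] by auto
    have test: "m u \<phi> + d w \<phi> + (m w \<psi> - a u \<psi>) = 0" if "u \<in> V" "w \<in> V" for u w
    proof -
      have "(\<Sum>j\<in>P <+> P. y j * row u w j) = 0" using y that by (auto simp: S_def)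
      then show ?thesis
        using P(1) that
        by (simp add: sum.Plus row_def psd_form_D(1)[OF m] psd_form_D(1)[OF a] psd_form_D(1)[OF d]
            sums distrib_left right_diff_distrib sum.distrib sum_subtractf)
    qed
    have "\<forall>x\<in>K. \<psi> x = 0 \<and> \<phi> x = 0"
    proof (rule saddle_unique[OF V m a d def V'(2,1)])
      fix q assume q: "q \<in> V"
      show "m \<psi> q + d \<phi> q = 0"
        using test[OF zero q] b0[OF m] b0[OF a] V' q
          psd_form_D(3)[OF m q V'(2)] psd_form_D(3)[OF d q V'(1)] by simp
      show "m \<phi> q = a \<psi> q"
        using test[OF q zero] b0[OF m] b0[OF d] V' q
          psd_form_D(3)[OF m q V'(1)] psd_form_D(3)[OF a q V'(2)] by simp
    qed auto
    then have "f \<phi> = 0" "g \<psi> = 0" using lin_on_zero f g V' by blast+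
    then show "(\<Sum>j\<in>P <+> P. y j * case_sum (\<lambda>i. f (e i)) (\<lambda>i. g (e i)) j) = 0"
      using P(1) by (simp add: sum.Plus sums[OF f] sums[OF g])
  qed
  then obtain u w where uw: "u \<in> V" "w \<in> V"
    and sol: "\<forall>j\<in>P <+> P. row u w j = case_sum (\<lambda>i. f (e i)) (\<lambda>i. g (e i)) j"
    unfolding S_def by blast
  have eqs: "m u (e i) + d w (e i) = f (e i)" "m w (e i) - a u (e i) = g (e i)" if "i \<in> P" for i
    using bspec[OF sol, of "Inl i"] bspec[OF sol, of "Inr i"] that
    by (simp_all add: row_def InlI InrI)
  have "m u \<phi> + d w \<phi> = f \<phi> \<and> m w \<phi> - a u \<phi> = g \<phi>" if \<phi>: "\<phi> \<in> V" for \<phi>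
  proof -
    obtain c where c: "\<forall>x\<in>K. \<phi> x = (\<Sum>i\<in>P. c i * e i x)" using span[OF \<phi>] by blast
    have eq: "h \<phi> = (\<Sum>i\<in>P. c i * h (e i))" if "lin_on K V h" for h
    proof -
      have "h \<phi> = h (\<lambda>x. \<Sum>i\<in>P. c i * e i x)"
        by (rule lin_on_cong[OF that fun_space_sum[OF V P] \<phi>]) (use c in auto)
      then show ?thesis using lin_on_sum[OF that V P] by simp
    qed
    show ?thesis
      using eqs by (simp add: eq[OF psd_form_D(1)[OF m]] eq[OF psd_form_D(1)[OF a]]
          eq[OF psd_form_D(1)[OF d]] eq[OF f] eq[OF g] uw
          flip: sum.distrib sum_subtractf distrib_left right_diff_distrib)
  qed
  then show ?thesis using uw by blast
qed

lemma saddle_unique_solution: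
  assumes V: "fun_space V" and m: "psd_form K V m" and a: "psd_form K V a" and d: "psd_form K V d"
    and def: "\<And>v. v \<in> V \<Longrightarrow> m v v = 0 \<Longrightarrow> \<forall>x\<in>K. v x = 0"
    and uw: "u \<in> V" "w \<in> V" "\<forall>\<phi>\<in>V. m u \<phi> + d w \<phi> = f \<phi> \<and> m w \<phi> - a u \<phi> = g \<phi>"
    and vz: "v \<in> V" "z \<in> V" "\<forall>\<phi>\<in>V. m v \<phi> + d z \<phi> = f \<phi> \<and> m z \<phi> - a v \<phi> = g \<phi>"
  shows "\<forall>x\<in>K. v x = u x \<and> z x = w x"
proof -
  define p where "p = (\<lambda>x. v x + (-1) * u x)"
  define q where "q = (\<lambda>x. z x + (-1) * w x)"
  have pq: "p \<in> V" "q \<in> V"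
    unfolding p_def q_def using V uw(1,2) vz(1,2) unfolding fun_space_def by blast+
  have left: "b p \<phi> = b v \<phi> - b u \<phi>" "b q \<phi> = b z \<phi> - b w \<phi>"
    if "psd_form K V b" "\<phi> \<in> V" for b \<phi>
    using psd_form_comb_left[OF that(1) vz(1) uw(1) pq(1) that(2), of "-1"]
      psd_form_comb_left[OF that(1) vz(2) uw(2) pq(2) that(2), of "-1"]
    by (simp_all add: p_def q_def)
  have "\<forall>x\<in>K. p x = 0 \<and> q x = 0"
  proof (rule saddle_unique[OF V m a d def pq])
    fix \<phi> assume \<phi>: "\<phi> \<in> V"
    show "m p \<phi> + d q \<phi> = 0"
      using bspec[OF uw(3) \<phi>] bspec[OF vz(3) \<phi>] by (simp add: left[OF m \<phi>] left[OF d \<phi>])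
    show "m q \<phi> = a p \<phi>"
      using bspec[OF uw(3) \<phi>] bspec[OF vz(3) \<phi>] by (simp add: left[OF m \<phi>] left[OF a \<phi>])
  qed auto
  then show ?thesis by (simp add: p_def q_def)
qed

section \<open>The fundamental lemma of the calculus of variations\<close>

text \<open>
  The derivative is carried as an explicit argument so that compositions and products can be
  differentiated by rule, independently of the choice made in \<^const>\<open>frechet_derivative\<close>.
\<close>

definition C1_with :: "('a::euclidean_space \<Rightarrow> real) \<Rightarrow> ('a \<Rightarrow> 'a \<Rightarrow> real) \<Rightarrow> bool" where
  "C1_with \<phi> D \<longleftrightarrow> (\<forall>x. (\<phi> has_derivative D x) (at x)) \<and> (\<forall>b. continuous_on UNIV (\<lambda>x. D x b))"

lemma C1_with_continuous: "C1_with \<phi> D \<Longrightarrow> continuous_on S \<phi>"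
  unfolding C1_with_def
  by (meson continuous_at_imp_continuous_on has_derivative_continuous)

lemma C1_with_const: "C1_with (\<lambda>x. c) (\<lambda>x h. 0)"
  unfolding C1_with_def by auto

lemma C1_with_mult:
  assumes "C1_with f D" "C1_with g E"
  shows "C1_with (\<lambda>x. f x * g x) (\<lambda>x h. f x * E x h + D x h * g x)"
  using assms C1_with_continuous[OF assms(1)] C1_with_continuous[OF assms(2)]
  unfolding C1_with_def by (auto intro!: has_derivative_mult continuous_intros)

lemma C1_with_prod:
  assumes "finite A" "\<And>i. i \<in> A \<Longrightarrow> \<exists>D. C1_with (f i) D"
  shows "\<exists>D. C1_with (\<lambda>x. \<Prod>i\<in>A. f i x) D"
  using assms
proof (induction A rule: finite_induct)
  case empty
  then show ?case using C1_with_const by auto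
next
  case (insert a A)
  obtain D where "C1_with (f a) D" using insert.prems by blast
  moreover obtain E where "C1_with (\<lambda>x. \<Prod>i\<in>A. f i x) E" using insert by blast
  ultimately show ?case using C1_with_mult insert.hyps by fastforce
qed

lemma C1_with_compose:
  assumes "C1_with \<phi> D" "\<And>x. (g has_real_derivative g' (\<phi> x)) (at (\<phi> x))"
    and "continuous_on UNIV (\<lambda>x. g' (\<phi> x))"
  shows "C1_with (\<lambda>x. g (\<phi> x)) (\<lambda>x h. g' (\<phi> x) * D x h)"
  unfolding C1_with_def
proof (intro conjI allI)
  fix x
  have "(\<phi> has_derivative D x) (at x)" using assms(1) by (simp add: C1_with_def)
  from has_derivative_compose[OF this assms(2)[unfolded has_field_derivative_def]]
  show "((\<lambda>x. g (\<phi> x)) has_derivative (\<lambda>h. g' (\<phi> x) * D x h)) (at x)" by simp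
next
  fix b show "continuous_on UNIV (\<lambda>x. g' (\<phi> x) * D x b)"
    using assms by (auto simp: C1_with_def intro!: continuous_intros)
qed

lemma test_functionsI:
  assumes "C1_with \<phi> D" "compact K" "K \<subseteq> \<Omega>" "\<And>x. x \<notin> K \<Longrightarrow> \<phi> x = 0"
  shows "\<phi> \<in> test_functions \<Omega>"
proof -
  have der: "(\<phi> has_derivative D x) (at x)" for x using assms(1) by (simp add: C1_with_def)
  have fr: "frechet_derivative \<phi> (at x) = D x" for x
    by (rule frechet_derivative_at[OF der, symmetric])
  have diff: "\<phi> differentiable (at x)" for x
    using der unfolding differentiable_def by blast
  have "closure {x. \<phi> x \<noteq> 0} \<subseteq> K"
    using assms(2,4) by (intro closure_minimal) (auto simp: compact_imp_closed)
  moreover from this have "compact (closure {x. \<phi> x \<noteq> 0})"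
    by (metis assms(2) closed_closure compact_Int_closed inf.absorb2)
  ultimately show ?thesis
    using assms(1,3) diff unfolding test_functions_def
    by (auto simp: C1_with_def fr)
qed

lemma DERIV_pos_part_square: "((\<lambda>t::real. (max 0 t)\<^sup>2) has_real_derivative 2 * max 0 t) (at t)"
proof -
  consider "t > 0" | "t < 0" | "t = 0" by linarith
  then show ?thesis
  proof cases
    case 1
    have "((\<lambda>t::real. t\<^sup>2) has_real_derivative 2 * max 0 t) (at t)"
      using 1 by (auto intro!: derivative_eq_intros)
    then show ?thesis
      by (rule has_field_derivative_transform_within_open[of _ _ _ "{0<..}"]) (use 1 in auto)
  next
    case 2
    have "((\<lambda>t::real. 0) has_real_derivative 2 * max 0 t) (at t)"
      using 2 by auto
    then show ?thesis
      by (rule has_field_derivative_transform_within_open[of _ _ _ "{..<0}"]) (use 2 in auto)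
  next
    case 3
    have "((\<lambda>h::real. (max 0 h)\<^sup>2 / h) \<longlongrightarrow> 0) (at 0)"
    proof (rule Lim_null_comparison)
      show "\<forall>\<^sub>F h in at 0. norm ((max 0 h)\<^sup>2 / h :: real) \<le> \<bar>h\<bar>"
        by (rule always_eventually) (auto simp: max_def power2_eq_square)
      show "((\<lambda>h::real. \<bar>h\<bar>) \<longlongrightarrow> 0) (at 0)"
        by (rule tendsto_eq_intros | simp)+
    qed
    then show ?thesis using 3 by (simp add: DERIV_def)
  qed
qed

text \<open>
  The witness is the product over the coordinates of squared positive parts. Squaring is what
  makes it continuously differentiable across the faces of the box.
\<close>

lemma C1_box_bump:
  fixes a c :: "'a::euclidean_space"
  obtains p D where "C1_with p D" "\<And>x. p x \<ge> 0" "\<And>x. p x > 0 \<longleftrightarrow> x \<in> box a c"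
proof -
  define p where "p = (\<lambda>x. \<Prod>b\<in>Basis. (max 0 (x \<bullet> b - a \<bullet> b))\<^sup>2 * (max 0 (c \<bullet> b - x \<bullet> b))\<^sup>2 :: real)"
  have aff: "C1_with (\<lambda>x. s * (x \<bullet> b) + t) (\<lambda>x h. s * (h \<bullet> b))" for s t :: real and b :: 'a
    unfolding C1_with_def by (auto intro!: derivative_eq_intros)
  have one: "C1_with (\<lambda>x. (max 0 (s * (x \<bullet> b) + t))\<^sup>2)
      (\<lambda>x h. 2 * max 0 (s * (x \<bullet> b) + t) * (s * (h \<bullet> b)))" for s t :: real and b :: 'a
    by (rule C1_with_compose[OF aff, where g="\<lambda>t. (max 0 t)\<^sup>2" and g'="\<lambda>t. 2 * max 0 t"])
      (auto intro!: DERIV_pos_part_square continuous_intros)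
  have "\<exists>D. C1_with p D" unfolding p_def
  proof (rule C1_with_prod)
    fix b :: 'a
    show "\<exists>D. C1_with (\<lambda>x. (max 0 (x \<bullet> b - a \<bullet> b))\<^sup>2 * (max 0 (c \<bullet> b - x \<bullet> b))\<^sup>2) D"
      using C1_with_mult[OF one[of 1 b "- (a \<bullet> b)"] one[of "-1" b "c \<bullet> b"]] by auto
  qed simp
  moreover have "p x \<ge> 0" for x unfolding p_def by (intro prod_nonneg) auto
  moreover have "p x > 0 \<longleftrightarrow> x \<in> box a c" for x
  proof
    assume "p x > 0"
    then have "p x \<noteq> 0" by simp
    then show "x \<in> box a c" unfolding p_def mem_box by (auto simp: max_def split: if_splits)
  next
    assume "x \<in> box a c"
    then show "p x > 0" unfolding p_def mem_box by (intro prod_pos) (auto simp: max_def)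
  qed
  ultimately show thesis using that by blast
qed

text \<open>
  The fundamental lemma of the calculus of variations. If \<open>p\<close> is the bump of a box, the functions
  \<open>n p / (1 + n p)\<close> are test functions with values in \<open>[0, 1]\<close> that converge to the indicator of the
  open box, so \<open>f\<close> has integral zero over every box inside \<open>\<Omega>\<close>. By Lebesgue differentiation along
  shrinking boxes, \<open>f\<close> vanishes almost everywhere.
\<close>

lemma fundamental_lemma:
  fixes f :: "'a::euclidean_space \<Rightarrow> real"
  assumes "open \<Omega>" and f: "integrable (lebesgue_on \<Omega>) f"
    and zero: "\<And>\<phi>. \<phi> \<in> test_functions \<Omega> \<Longrightarrow> (LINT x|lebesgue_on \<Omega>. f x * \<phi> x) = 0"
  shows "AE x in lebesgue_on \<Omega>. f x = 0"
proof -
  have \<Omega>: "\<Omega> \<in> sets lebesgue" using assms(1) by simp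
  define F where "F = (\<lambda>x. indicator \<Omega> x *\<^sub>R f x)"
  have F: "integrable lebesgue F"
    using f \<Omega> by (simp add: F_def integrable_restrict_space)
  have box0: "integral (cbox a c) F = 0" if sub: "cbox a c \<subseteq> \<Omega>" for a c
  proof -
    obtain p D where p: "C1_with p D" "\<And>x. p x \<ge> 0" "\<And>x. p x > 0 \<longleftrightarrow> x \<in> box a c"
      using C1_box_bump by blast
    define \<phi> where "\<phi> = (\<lambda>(n::nat) x. real n * p x / (1 + real n * p x))"
    have pos: "1 + real n * p x > 0" for n x using p(2)[of x] by (simp add: add_pos_nonneg)
    have C1: "C1_with (\<phi> n) (\<lambda>x h. real n / (1 + real n * p x)\<^sup>2 * D x h)" for n
      unfolding \<phi>_def
    proof (rule C1_with_compose[OF p(1), where g="\<lambda>t. real n * t / (1 + real n * t)"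
          and g'="\<lambda>t. real n / (1 + real n * t)\<^sup>2"])
      fix x
      show "((\<lambda>t. real n * t / (1 + real n * t)) has_real_derivative
          real n / (1 + real n * p x)\<^sup>2) (at (p x))"
        using pos[of n x] by (auto intro!: derivative_eq_intros simp: field_simps power2_eq_square)
      show "continuous_on UNIV (\<lambda>x. real n / (1 + real n * p x)\<^sup>2)"
        using pos by (auto intro!: continuous_intros C1_with_continuous[OF p(1)] simp: less_imp_neq[THEN not_sym])
    qed
    have out: "\<phi> n x = 0" if "x \<notin> cbox a c" for n x
      using that p(2,3)[of x] box_subset_cbox[of a c] by (force simp: \<phi>_def)
    have "\<phi> n \<in> test_functions \<Omega>" for n
      by (rule test_functionsI[OF C1 compact_cbox sub out])
    then have null: "(LINT x|lebesgue_on \<Omega>. f x * \<phi> n x) = 0" for n by (rule zero)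
    have "(\<lambda>n. LINT x|lebesgue_on \<Omega>. f x * \<phi> n x) \<longlonglongrightarrow> (LINT x|lebesgue_on \<Omega>. f x * indicator (box a c) x)"
    proof (rule integral_dominated_convergence[where w="\<lambda>x. norm (f x)"])
      have "(indicator (box a c) :: 'a \<Rightarrow> real) \<in> borel_measurable (lebesgue_on \<Omega>)"
        by (intro measurable_restrict_space1 borel_measurable_indicator) auto
      then show "(\<lambda>x. f x * indicator (box a c) x) \<in> borel_measurable (lebesgue_on \<Omega>)"
        by (rule borel_measurable_times[OF borel_measurable_integrable[OF f]])
      show "(\<lambda>x. f x * \<phi> n x) \<in> borel_measurable (lebesgue_on \<Omega>)" for n
        by (intro borel_measurable_times borel_measurable_integrable[OF f]
            continuous_imp_measurable_on_sets_lebesgue C1_with_continuous[OF C1] \<Omega>)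
      show "integrable (lebesgue_on \<Omega>) (\<lambda>x. norm (f x))" using f by simp
      show "AE x in lebesgue_on \<Omega>. (\<lambda>n. f x * \<phi> n x) \<longlonglongrightarrow> f x * indicator (box a c) x"
      proof (intro AE_I2 tendsto_mult_left)
        fix x
        show "(\<lambda>n. \<phi> n x) \<longlonglongrightarrow> indicator (box a c) x"
        proof (cases "x \<in> box a c")
          case True
          then have "p x > 0" using p(3) by simp
          then have "(\<lambda>n. real n * p x / (1 + real n * p x)) \<longlonglongrightarrow> 1"
            by real_asymp
          then show ?thesis using True by (simp add: \<phi>_def)
        next
          case False
          then have "p x = 0" using p(2,3)[of x] by force
          then show ?thesis using False by (simp add: \<phi>_def)
        qed
      qed
      show "AE x in lebesgue_on \<Omega>. norm (f x * \<phi> n x) \<le> norm (f x)" for n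
      proof (intro AE_I2)
        fix x
        have "0 \<le> \<phi> n x" "\<phi> n x \<le> 1" using p(2)[of x] pos[of n x] by (auto simp: \<phi>_def)
        then show "norm (f x * \<phi> n x) \<le> norm (f x)"
          by (simp add: abs_mult mult_left_le)
      qed
    qed
    then have "(LINT x|lebesgue_on \<Omega>. f x * indicator (box a c) x) = 0"
      using null by (simp add: LIMSEQ_const_iff)
    moreover have "(LINT x|lebesgue_on \<Omega>. f x * indicator (box a c) x)
        = (LINT x|lebesgue_on (box a c). F x)"
      using \<Omega> by (simp add: integral_restrict_space F_def ac_simps)
    moreover have "(LINT x|lebesgue_on (box a c). F x) = integral (box a c) F"
      using integrable_mult_indicator[OF _ F, of "box a c"]
      by (intro lebesgue_integral_eq_integral) (auto simp: integrable_restrict_space)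
    ultimately show ?thesis by (simp add: integral_open_interval)
  qed
  have "F integrable_on cbox a c" for a c
    using integrable_on_lebesgue[OF F] integrable_on_subcbox by blast
  then obtain N where N: "negligible N"
    "\<And>x e. x \<notin> N \<Longrightarrow> 0 < e \<Longrightarrow> \<exists>d>0. \<forall>h. 0 < h \<and> h < d \<longrightarrow>
       norm (integral (cbox x (x + h *\<^sub>R One)) F /\<^sub>R h ^ DIM('a) - F x) < e"
    using integrable_ccontinuous_explicit[of F] by blast
  have van: "F x = 0" if x: "x \<in> \<Omega>" "x \<notin> N" for x
  proof (rule ccontr)
    assume "F x \<noteq> 0"
    then obtain d where d: "d > 0" "\<And>h. 0 < h \<Longrightarrow> h < d \<Longrightarrow>
       norm (integral (cbox x (x + h *\<^sub>R One)) F /\<^sub>R h ^ DIM('a) - F x) < norm (F x)"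
      using N(2)[OF x(2), of "norm (F x)"] by auto
    obtain r where r: "r > 0" "ball x r \<subseteq> \<Omega>" using assms(1) x(1) openE by blast
    \<comment> \<open>The box with corner \<open>x\<close> and edge \<open>h\<close> lies within \<open>h * DIM('a)\<close> of \<open>x\<close> (the 1-norm bounds the norm).\<close>
    define h where "h = min (d / 2) (r / (2 * real DIM('a)))"
    have h: "h > 0" "h < d" "h * real DIM('a) < r"
    proof -
      show "h > 0" "h < d" using d(1) r(1) by (auto simp: h_def)
      have "h * real DIM('a) \<le> r / (2 * real DIM('a)) * real DIM('a)"
        by (intro mult_right_mono) (auto simp: h_def)
      then show "h * real DIM('a) < r" using r(1) by simp
    qed
    have "cbox x (x + h *\<^sub>R One) \<subseteq> ball x r"
    proof
      fix y assume y: "y \<in> cbox x (x + h *\<^sub>R One)"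
      have "norm (y - x) \<le> (\<Sum>b\<in>Basis. \<bar>(y - x) \<bullet> b\<bar>)" by (rule norm_le_l1)
      also have "\<dots> \<le> (\<Sum>b\<in>(Basis::'a set). h)"
        using y by (intro sum_mono) (auto simp: mem_box inner_simps)
      finally show "y \<in> ball x r" using h(3) by (simp add: dist_norm norm_minus_commute mult.commute)
    qed
    then have "integral (cbox x (x + h *\<^sub>R One)) F = 0" using r(2) box0 by blast
    then show False using d(2)[OF h(1,2)] by simp
  qed
  have "AE x in lebesgue. x \<notin> N"
    using N(1) by (intro AE_not_in) (simp add: negligible_iff_null_sets)
  then have "AE x in lebesgue. x \<in> \<Omega> \<longrightarrow> f x = 0"
    by eventually_elim (use van in \<open>auto simp: F_def\<close>)
  then show ?thesis using \<Omega> by (simp add: AE_restrict_space_iff)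
qed

section \<open>Square-integrable and continuous functions\<close>

lemma L2_D:
  assumes "f \<in> L2 \<Omega>"
  shows "f \<in> borel_measurable (lebesgue_on \<Omega>)" "integrable (lebesgue_on \<Omega>) (\<lambda>x. (norm (f x))\<^sup>2)"
  using assms by (auto simp: L2_def)

text \<open>
  The bounded weight \<open>a\<close> covers the uses of the lemma at once: coefficients of the forms, test
  functions with their derivatives, and \<open>a = 1\<close>.
\<close>

lemma L2_integrable_mult:
  assumes f: "f \<in> L2 \<Omega>" and g: "g \<in> L2 \<Omega>"
    and a: "a \<in> borel_measurable (lebesgue_on \<Omega>)" "\<And>x. x \<in> \<Omega> \<Longrightarrow> \<bar>a x\<bar> \<le> C"
  shows "integrable (lebesgue_on \<Omega>) (\<lambda>x. a x * (f x \<bullet> g x))"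
proof (rule Bochner_Integration.integrable_bound)
  show "integrable (lebesgue_on \<Omega>) (\<lambda>x. C * ((norm (f x))\<^sup>2 + (norm (g x))\<^sup>2))"
    using L2_D[OF f] L2_D[OF g] by auto
  show "(\<lambda>x. a x * (f x \<bullet> g x)) \<in> borel_measurable (lebesgue_on \<Omega>)"
    using L2_D[OF f] L2_D[OF g] a(1) by measurable
  have "\<bar>a x * (f x \<bullet> g x)\<bar> \<le> C * ((norm (f x))\<^sup>2 + (norm (g x))\<^sup>2)" if "x \<in> \<Omega>" for x
  proof -
    have "\<bar>f x \<bullet> g x\<bar> \<le> norm (f x) * norm (g x)" by (rule Cauchy_Schwarz_ineq2)
    also have "\<dots> \<le> (norm (f x))\<^sup>2 + (norm (g x))\<^sup>2"
      using sum_squares_bound[of "norm (f x)" "norm (g x)"]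
        mult_nonneg_nonneg[OF norm_ge_zero[of "f x"] norm_ge_zero[of "g x"]] by linarith
    finally show ?thesis
      using a(2)[OF that] by (simp add: abs_mult mult_mono)
  qed
  then show "AE x in lebesgue_on \<Omega>. norm (a x * (f x \<bullet> g x)) \<le> norm (C * ((norm (f x))\<^sup>2 + (norm (g x))\<^sup>2))"
    by (intro AE_I2) (simp add: space_restrict_space order_trans[OF _ abs_ge_self])
qed

lemma L2_comb:
  assumes q: "q \<in> L2 \<Omega>" and v: "v \<in> L2 \<Omega>"
  shows "(\<lambda>x. q x + c *\<^sub>R v x) \<in> L2 \<Omega>"
proof -
  have "integrable (lebesgue_on \<Omega>) (\<lambda>x. (norm (q x + c *\<^sub>R v x))\<^sup>2)"
  proof (rule Bochner_Integration.integrable_bound)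
    show "integrable (lebesgue_on \<Omega>) (\<lambda>x. 2 * (norm (q x))\<^sup>2 + 2 * c\<^sup>2 * (norm (v x))\<^sup>2)"
      using L2_D[OF q] L2_D[OF v] by auto
    show "(\<lambda>x. (norm (q x + c *\<^sub>R v x))\<^sup>2) \<in> borel_measurable (lebesgue_on \<Omega>)"
      using L2_D[OF q] L2_D[OF v] by measurable
    have "(norm (q x + c *\<^sub>R v x))\<^sup>2 \<le> 2 * (norm (q x))\<^sup>2 + 2 * c\<^sup>2 * (norm (v x))\<^sup>2" for x
    proof -
      have "(norm (q x + c *\<^sub>R v x))\<^sup>2 \<le> (norm (q x) + norm (c *\<^sub>R v x))\<^sup>2"
        by (intro power_mono norm_triangle_ineq) auto
      also have "\<dots> \<le> 2 * (norm (q x))\<^sup>2 + 2 * (norm (c *\<^sub>R v x))\<^sup>2"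
        using sum_squares_bound[of "norm (q x)" "norm (c *\<^sub>R v x)"] by (simp add: power2_sum)
      finally show ?thesis by (simp add: power_mult_distrib)
    qed
    then show "AE x in lebesgue_on \<Omega>. norm ((norm (q x + c *\<^sub>R v x))\<^sup>2)
        \<le> norm (2 * (norm (q x))\<^sup>2 + 2 * c\<^sup>2 * (norm (v x))\<^sup>2)"
      by (intro AE_I2) (auto intro: order_trans)
  qed
  then show ?thesis using L2_D[OF q] L2_D[OF v] by (simp add: L2_def)
qed

lemma L2_cong:
  assumes "\<And>x. x \<in> \<Omega> \<Longrightarrow> f x = g x" "\<Omega> \<in> sets lebesgue" "f \<in> L2 \<Omega>"
  shows "g \<in> L2 \<Omega>"
proof -
  have "f \<in> borel_measurable (lebesgue_on \<Omega>) \<longleftrightarrow> g \<in> borel_measurable (lebesgue_on \<Omega>)"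
    using assms(1) by (intro measurable_cong) (auto simp: space_restrict_space)
  moreover have "integrable (lebesgue_on \<Omega>) (\<lambda>x. (norm (f x))\<^sup>2) \<longleftrightarrow>
      integrable (lebesgue_on \<Omega>) (\<lambda>x. (norm (g x))\<^sup>2)"
    using assms(1) by (intro Bochner_Integration.integrable_cong) (auto simp: space_restrict_space)
  ultimately show ?thesis using assms(3) by (simp add: L2_def)
qed

lemma C0_bounded:
  fixes f :: "'a::euclidean_space \<Rightarrow> real"
  assumes "bounded \<Omega>" "f \<in> C0 \<Omega>"
  obtains C where "\<And>x. x \<in> closure \<Omega> \<Longrightarrow> \<bar>f x\<bar> \<le> C"
proof -
  have "bounded (f ` closure \<Omega>)"
    using assms by (intro compact_imp_bounded compact_continuous_image)
      (auto simp: C0_def compact_closure)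
  then show thesis using that unfolding bounded_iff by auto
qed

lemma C0_measurable:
  fixes f :: "'a::euclidean_space \<Rightarrow> real"
  assumes "open \<Omega>" "f \<in> C0 \<Omega>"
  shows "f \<in> borel_measurable (lebesgue_on \<Omega>)"
  using assms closure_subset
  by (intro continuous_imp_measurable_on_sets_lebesgue) (auto simp: C0_def intro: continuous_on_subset)

lemma finite_measure_bounded_domain:
  fixes \<Omega> :: "'a::euclidean_space set"
  assumes "open \<Omega>" "bounded \<Omega>"
  shows "finite_measure (lebesgue_on \<Omega>)"
  using assms by (intro finite_measure_lebesgue_on lmeasurable_open)

lemma C0_integrable:
  fixes f :: "'a::euclidean_space \<Rightarrow> real"
  assumes "open \<Omega>" "bounded \<Omega>" "f \<in> C0 \<Omega>"
  shows "integrable (lebesgue_on \<Omega>) f"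
proof -
  interpret finite_measure "lebesgue_on \<Omega>" by (rule finite_measure_bounded_domain[OF assms(1,2)])
  obtain C where C: "\<And>x. x \<in> closure \<Omega> \<Longrightarrow> \<bar>f x\<bar> \<le> C" using C0_bounded assms by blast
  show ?thesis
    by (rule integrable_const_bound[of _ C])
      (use C C0_measurable[OF assms(1,3)] closure_subset[of \<Omega>] in
        \<open>auto intro!: AE_I2 simp: space_restrict_space\<close>)
qed

lemma C0_mult: "f \<in> C0 \<Omega> \<Longrightarrow> g \<in> C0 \<Omega> \<Longrightarrow> (\<lambda>x. f x * g x) \<in> C0 \<Omega>"
  by (auto simp: C0_def intro!: continuous_intros)

lemma C0_comb: "f \<in> C0 \<Omega> \<Longrightarrow> g \<in> C0 \<Omega> \<Longrightarrow> (\<lambda>x. f x + c * g x) \<in> C0 \<Omega>"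
  by (auto simp: C0_def intro!: continuous_intros)

lemma C0_const: "(\<lambda>x. c) \<in> C0 \<Omega>"
  by (auto simp: C0_def)

lemma C0_cong: "(\<And>x. x \<in> closure \<Omega> \<Longrightarrow> f x = g x) \<Longrightarrow> f \<in> C0 \<Omega> \<Longrightarrow> g \<in> C0 \<Omega>"
  unfolding C0_def using continuous_on_cong[of "closure \<Omega>" "closure \<Omega>" f g] by auto

lemma C0_L2:
  fixes f :: "'a::euclidean_space \<Rightarrow> real"
  assumes "open \<Omega>" "bounded \<Omega>" "f \<in> C0 \<Omega>"
  shows "f \<in> L2 \<Omega>"
  using C0_measurable[OF assms(1,3)] C0_integrable[OF assms(1,2) C0_mult[OF assms(3,3)]]
  by (simp add: L2_def power2_eq_square)

section \<open>Weak gradients\<close>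

lemma test_function_facts:
  assumes \<phi>: "\<phi> \<in> test_functions \<Omega>" and b: "b \<in> Basis"
  shows "continuous_on S \<phi>"
    and "continuous_on S (\<lambda>x. frechet_derivative \<phi> (at x) b)"
    and "x \<notin> closure {x. \<phi> x \<noteq> 0} \<Longrightarrow> \<phi> x = 0"
    and "x \<notin> closure {x. \<phi> x \<noteq> 0} \<Longrightarrow> frechet_derivative \<phi> (at x) b = 0"
proof -
  show "continuous_on S \<phi>"
    using \<phi> unfolding test_functions_def
    by (auto intro!: continuous_at_imp_continuous_on differentiable_imp_continuous_within)
  show "continuous_on S (\<lambda>x. frechet_derivative \<phi> (at x) b)"
    using \<phi> b unfolding test_functions_def by (auto intro: continuous_on_subset)
  show "\<phi> x = 0" if "x \<notin> closure {x. \<phi> x \<noteq> 0}"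
    using that closure_subset[of "{x. \<phi> x \<noteq> 0}"] by blast
  show "frechet_derivative \<phi> (at x) b = 0" if x: "x \<notin> closure {x. \<phi> x \<noteq> 0}"
  proof -
    have "((\<lambda>x. 0) has_derivative (\<lambda>h. 0)) (at x)" by simp
    then have "(\<phi> has_derivative (\<lambda>h. 0)) (at x)"
      by (rule has_derivative_transform_within_open[of _ _ _ _ "- closure {x. \<phi> x \<noteq> 0}"])
        (use x closure_subset[of "{x. \<phi> x \<noteq> 0}"] in auto)
    from frechet_derivative_at[OF this] show ?thesis by metis
  qed
qed

lemma test_function_bounded:
  assumes \<phi>: "\<phi> \<in> test_functions \<Omega>" and b: "b \<in> Basis"
  obtains C where "\<And>x. \<bar>\<phi> x\<bar> \<le> C" "\<And>x. \<bar>frechet_derivative \<phi> (at x) b\<bar> \<le> C"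
proof -
  let ?K = "closure {x. \<phi> x \<noteq> 0}"
  have K: "compact ?K" using \<phi> by (simp add: test_functions_def)
  note facts = test_function_facts[OF \<phi> b]
  have "bounded (\<phi> ` ?K)" "bounded ((\<lambda>x. frechet_derivative \<phi> (at x) b) ` ?K)"
    using facts(1,2) K by (intro compact_imp_bounded compact_continuous_image; blast)+
  then obtain C1 C2 where C: "\<And>x. x \<in> ?K \<Longrightarrow> \<bar>\<phi> x\<bar> \<le> C1"
    "\<And>x. x \<in> ?K \<Longrightarrow> \<bar>frechet_derivative \<phi> (at x) b\<bar> \<le> C2"
    unfolding bounded_iff by auto
  show thesis
  proof (rule that[of "max 0 (max C1 C2)"])
    fix x
    show "\<bar>\<phi> x\<bar> \<le> max 0 (max C1 C2)"
      using C(1)[of x] facts(3)[of x] by (cases "x \<in> ?K") auto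
    show "\<bar>frechet_derivative \<phi> (at x) b\<bar> \<le> max 0 (max C1 C2)"
      using C(2)[of x] facts(4)[of x] by (cases "x \<in> ?K") auto
  qed
qed

text \<open>
  Each component of the difference integrates to zero against all test functions. The choice made
  in \<^const>\<open>weak_gradient\<close> is therefore immaterial, which is what makes it linear almost everywhere.
\<close>

lemma weak_gradient_unique:
  fixes \<Omega> :: "'a::euclidean_space set"
  assumes \<Omega>: "open \<Omega>" "bounded \<Omega>"
    and g: "g \<in> L2 \<Omega>" "has_weak_gradient \<Omega> f g"
    and h: "h \<in> L2 \<Omega>" "has_weak_gradient \<Omega> f h"
  shows "AE x in lebesgue_on \<Omega>. g x = h x"
proof -
  have int: "integrable (lebesgue_on \<Omega>) (\<lambda>x. (k x \<bullet> b) * \<phi> x)"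
    if k: "k \<in> L2 \<Omega>" and \<phi>: "\<phi> \<in> borel_measurable (lebesgue_on \<Omega>)" "\<And>x. \<bar>\<phi> x\<bar> \<le> C"
    for k :: "'a \<Rightarrow> 'a" and \<phi> C b
  proof -
    interpret finite_measure "lebesgue_on \<Omega>" by (rule finite_measure_bounded_domain[OF \<Omega>])
    have "(\<lambda>x. b) \<in> L2 \<Omega>" by (simp add: L2_def)
    from L2_integrable_mult[OF k this \<phi>(1), of C] \<phi>(2) show ?thesis by (simp add: mult.commute)
  qed
  have comp: "AE x in lebesgue_on \<Omega>. (g x - h x) \<bullet> b = 0" if b: "b \<in> Basis" for b
  proof (rule fundamental_lemma[OF \<Omega>(1)])
    show "integrable (lebesgue_on \<Omega>) (\<lambda>x. (g x - h x) \<bullet> b)"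
      using int[OF g(1), of "\<lambda>x. 1" 1 b] int[OF h(1), of "\<lambda>x. 1" 1 b]
      by (simp add: inner_diff_left)
    fix \<phi> assume \<phi>: "\<phi> \<in> test_functions \<Omega>"
    have m: "\<phi> \<in> borel_measurable (lebesgue_on \<Omega>)"
      using \<Omega>(1) test_function_facts(1)[OF \<phi> b]
      by (intro continuous_imp_measurable_on_sets_lebesgue) auto
    obtain C where C: "\<And>x. \<bar>\<phi> x\<bar> \<le> C" using test_function_bounded[OF \<phi> b] by blast
    have "(LINT x|lebesgue_on \<Omega>. ((g x - h x) \<bullet> b) * \<phi> x)
        = (LINT x|lebesgue_on \<Omega>. (g x \<bullet> b) * \<phi> x) - (LINT x|lebesgue_on \<Omega>. (h x \<bullet> b) * \<phi> x)"
      using int[OF g(1) m C, of b] int[OF h(1) m C, of b]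
      by (simp add: inner_diff_left left_diff_distrib)
    also have "\<dots> = 0"
      using bspec[OF bspec[OF g(2)[unfolded has_weak_gradient_def] \<phi>] b]
        bspec[OF bspec[OF h(2)[unfolded has_weak_gradient_def] \<phi>] b] by simp
    finally show "(LINT x|lebesgue_on \<Omega>. ((g x - h x) \<bullet> b) * \<phi> x) = 0" .
  qed
  then have "AE x in lebesgue_on \<Omega>. \<forall>b\<in>Basis. (g x - h x) \<bullet> b = 0"
    by (intro AE_finite_allI) auto
  then show ?thesis
    by eventually_elim (auto simp: euclidean_all_zero_iff)
qed

lemma weak_gradient_spec:
  assumes "f \<in> H1 \<Omega>"
  shows "weak_gradient \<Omega> f \<in> L2 \<Omega>" "has_weak_gradient \<Omega> f (weak_gradient \<Omega> f)"
proof -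
  have "\<exists>g. g \<in> L2 \<Omega> \<and> has_weak_gradient \<Omega> f g" using assms by (auto simp: H1_def)
  from someI_ex[OF this] show "weak_gradient \<Omega> f \<in> L2 \<Omega>"
    "has_weak_gradient \<Omega> f (weak_gradient \<Omega> f)" by (simp_all add: weak_gradient_def)
qed

lemma has_weak_gradient_comb:
  assumes \<Omega>: "open \<Omega>" "bounded \<Omega>"
    and q: "q \<in> L2 \<Omega>" "g \<in> L2 \<Omega>" "has_weak_gradient \<Omega> q g"
    and v: "v \<in> L2 \<Omega>" "h \<in> L2 \<Omega>" "has_weak_gradient \<Omega> v h"
    and z: "\<And>x. x \<in> \<Omega> \<Longrightarrow> z x = q x + c * v x"
  shows "has_weak_gradient \<Omega> z (\<lambda>x. g x + c *\<^sub>R h x)"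
  unfolding has_weak_gradient_def
proof (intro ballI)
  fix \<phi> b assume \<phi>: "\<phi> \<in> test_functions \<Omega>" and b: "b \<in> (Basis :: 'a set)"
  interpret finite_measure "lebesgue_on \<Omega>" by (rule finite_measure_bounded_domain[OF \<Omega>])
  let ?d = "\<lambda>x. frechet_derivative \<phi> (at x) b"
  obtain C where C: "\<And>x. \<bar>\<phi> x\<bar> \<le> C" "\<And>x. \<bar>?d x\<bar> \<le> C" using test_function_bounded[OF \<phi> b] by blast
  have m: "\<phi> \<in> borel_measurable (lebesgue_on \<Omega>)" "?d \<in> borel_measurable (lebesgue_on \<Omega>)"
    using \<Omega>(1) test_function_facts(1,2)[OF \<phi> b]
    by (intro continuous_imp_measurable_on_sets_lebesgue; auto)+
  have cst: "(\<lambda>x. k) \<in> L2 \<Omega>" for k :: "'c::euclidean_space" by (simp add: L2_def)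
  have i1: "integrable (lebesgue_on \<Omega>) (\<lambda>x. f x * ?d x)" if "f \<in> L2 \<Omega>" for f
    using L2_integrable_mult[OF that cst[of 1] m(2) C(2)] by (simp add: mult.commute)
  have i2: "integrable (lebesgue_on \<Omega>) (\<lambda>x. (k x \<bullet> b) * \<phi> x)" if "k \<in> L2 \<Omega>" for k
    using L2_integrable_mult[OF that cst[of b] m(1) C(1)] by (simp add: mult.commute)
  have "(LINT x|lebesgue_on \<Omega>. z x * ?d x) = (LINT x|lebesgue_on \<Omega>. q x * ?d x + c * (v x * ?d x))"
    by (intro Bochner_Integration.integral_cong) (auto simp: space_restrict_space z algebra_simps)
  also have "\<dots> = (LINT x|lebesgue_on \<Omega>. q x * ?d x) + c * (LINT x|lebesgue_on \<Omega>. v x * ?d x)"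
    using i1[OF q(1)] i1[OF v(1)] by simp
  also have "\<dots> = - (LINT x|lebesgue_on \<Omega>. (g x \<bullet> b) * \<phi> x) - c * (LINT x|lebesgue_on \<Omega>. (h x \<bullet> b) * \<phi> x)"
    using q(3) v(3) \<phi> b by (simp add: has_weak_gradient_def)
  also have "\<dots> = - (LINT x|lebesgue_on \<Omega>. (g x \<bullet> b) * \<phi> x + c * ((h x \<bullet> b) * \<phi> x))"
    using i2[OF q(2)] i2[OF v(2)] by simp
  also have "\<dots> = - (LINT x|lebesgue_on \<Omega>. ((g x + c *\<^sub>R h x) \<bullet> b) * \<phi> x)"
    by (simp add: inner_add_left algebra_simps)
  finally show "(LINT x|lebesgue_on \<Omega>. z x * ?d x) = - (LINT x|lebesgue_on \<Omega>. ((g x + c *\<^sub>R h x) \<bullet> b) * \<phi> x)" .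
qed

lemma H1_comb:
  assumes \<Omega>: "open \<Omega>" "bounded \<Omega>" and q: "q \<in> H1 \<Omega>" and v: "v \<in> H1 \<Omega>"
    and z: "\<And>x. x \<in> \<Omega> \<Longrightarrow> z x = q x + c * v x"
  shows "z \<in> H1 \<Omega>"
    and "AE x in lebesgue_on \<Omega>. weak_gradient \<Omega> z x = weak_gradient \<Omega> q x + c *\<^sub>R weak_gradient \<Omega> v x"
proof -
  have L: "q \<in> L2 \<Omega>" "v \<in> L2 \<Omega>" using q v by (auto simp: H1_def)
  note wq = weak_gradient_spec[OF q] and wv = weak_gradient_spec[OF v]
  have wz: "has_weak_gradient \<Omega> z (\<lambda>x. weak_gradient \<Omega> q x + c *\<^sub>R weak_gradient \<Omega> v x)"
    by (rule has_weak_gradient_comb[OF \<Omega> L(1) wq L(2) wv z])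
  have gL: "(\<lambda>x. weak_gradient \<Omega> q x + c *\<^sub>R weak_gradient \<Omega> v x) \<in> L2 \<Omega>"
    by (rule L2_comb[OF wq(1) wv(1)])
  have "z \<in> L2 \<Omega>"
    by (rule L2_cong[OF _ _ L2_comb[OF L, of c]]) (use z \<Omega> in auto)
  then show "z \<in> H1 \<Omega>" using wz gL by (auto simp: H1_def)
  from weak_gradient_unique[OF \<Omega> weak_gradient_spec[OF this] gL wz]
  show "AE x in lebesgue_on \<Omega>. weak_gradient \<Omega> z x = weak_gradient \<Omega> q x + c *\<^sub>R weak_gradient \<Omega> v x" .
qed

text \<open>
  The integral of a difference quotient of \<open>\<phi>\<close> vanishes by translation invariance of Lebesgue
  measure. By the mean value theorem the quotients are bounded by a multiple of the indicator of
  one fixed ball, so dominated convergence carries the zero over to the derivative.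
\<close>

lemma integral_test_derivative_zero:
  fixes \<Omega> :: "'a::euclidean_space set"
  assumes \<Omega>: "open \<Omega>" and \<phi>: "\<phi> \<in> test_functions \<Omega>" and b: "b \<in> Basis"
  shows "(LINT x|lebesgue_on \<Omega>. frechet_derivative \<phi> (at x) b) = 0"
proof -
  let ?d = "\<lambda>x. frechet_derivative \<phi> (at x) b"
  let ?K = "closure {x. \<phi> x \<noteq> 0}"
  note facts = test_function_facts[OF \<phi> b]
  have K: "compact ?K" "?K \<subseteq> \<Omega>" using \<phi> by (auto simp: test_functions_def)
  obtain C where C: "\<And>x. \<bar>\<phi> x\<bar> \<le> C" "\<And>x. \<bar>?d x\<bar> \<le> C" using test_function_bounded[OF \<phi> b] by blast
  obtain R where R: "\<And>x. x \<in> ?K \<Longrightarrow> norm x \<le> R"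
    using compact_imp_bounded[OF K(1)] unfolding bounded_iff by blast
  \<comment> \<open>The increments used below are at most \<open>1\<close>, so the enlarged ball also catches the shifted supports.\<close>
  define G where "G = cball (0::'a) (R + 1)"
  have G: "G \<in> sets borel" "emeasure lborel G < \<infinity>"
    using emeasure_bounded_finite[of G] by (auto simp: G_def)
  have meas: "\<phi> \<in> borel_measurable borel" "?d \<in> borel_measurable borel"
    using facts(1,2) by (auto intro: borel_measurable_continuous_onI)
  have inG: "x \<in> G" if "x + t *\<^sub>R b \<in> ?K" "0 \<le> t" "t \<le> 1" for x t
  proof -
    have "norm x \<le> norm (x + t *\<^sub>R b) + norm (t *\<^sub>R b)"
      using norm_triangle_ineq4[of "x + t *\<^sub>R b" "t *\<^sub>R b"] by simp
    then show ?thesis using R[OF that(1)] that b by (simp add: G_def)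
  qed
  have inG0: "x \<in> G" if "x \<in> ?K" for x using inG[of x 0] that by simp
  have int\<phi>: "integrable lborel \<phi>"
  proof (rule integrableI_bounded_set[where A=G and B=C])
    show "AE x in lborel. x \<in> G \<longrightarrow> norm (\<phi> x) \<le> C" using C(1) by simp
    show "AE x in lborel. x \<notin> G \<longrightarrow> \<phi> x = 0" using facts(3) inG0 by (intro AE_I2) blast
  qed (use G meas in simp_all)
  have intG: "integrable lborel (\<lambda>x. C * indicator G x)"
    using G by (intro integrable_mult_right integrable_real_indicator) auto
  have line: "((\<lambda>s. \<phi> (x + s *\<^sub>R b)) has_real_derivative ?d (x + t *\<^sub>R b)) (at t)" for x t
  proof -
    have "(\<phi> has_derivative frechet_derivative \<phi> (at (x + t *\<^sub>R b))) (at (x + t *\<^sub>R b))"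
      using \<phi> by (auto simp: test_functions_def frechet_derivative_works)
    moreover have "((\<lambda>s. x + s *\<^sub>R b) has_derivative (\<lambda>s. s *\<^sub>R b)) (at t)"
      by (auto intro!: derivative_eq_intros)
    ultimately have "((\<lambda>s. \<phi> (x + s *\<^sub>R b)) has_derivative
        (\<lambda>s. frechet_derivative \<phi> (at (x + t *\<^sub>R b)) (s *\<^sub>R b))) (at t)"
      by (rule has_derivative_compose[rotated])
    moreover have "frechet_derivative \<phi> (at (x + t *\<^sub>R b)) (s *\<^sub>R b) = ?d (x + t *\<^sub>R b) * s" for s
      using \<phi> by (simp add: test_functions_def linear_cmul[OF linear_frechet_derivative])
    ultimately show ?thesis by (simp add: has_field_derivative_def)
  qed
  define h where "h = (\<lambda>n. inverse (real (Suc n)))"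
  have h: "h n > 0" "h n \<le> 1" for n by (auto simp: h_def field_simps)
  define X where "X = (\<lambda>n x. (\<phi> (x + h n *\<^sub>R b) - \<phi> x) / h n)"
  have null: "(LINT x|lborel. X n x) = 0" for n
  proof -
    have "integrable (distr lborel borel ((+) (h n *\<^sub>R b))) \<phi>"
      using int\<phi> by (simp add: lborel_distr_plus)
    then have i: "integrable lborel (\<lambda>x. \<phi> (h n *\<^sub>R b + x))"
      by (subst (asm) integrable_distr_eq) (use meas in auto)
    have "(LINT x|lborel. \<phi> (h n *\<^sub>R b + x)) = (LINT x|distr lborel borel ((+) (h n *\<^sub>R b)). \<phi> x)"
      by (subst integral_distr) (use meas in auto)
    then show ?thesis
      using i int\<phi> by (simp add: X_def lborel_distr_plus add.commute)
  qed
  have "(\<lambda>n. LINT x|lborel. X n x) \<longlonglongrightarrow> (LINT x|lborel. ?d x)"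
  proof (rule integral_dominated_convergence[OF _ _ intG])
    show "?d \<in> borel_measurable lborel" using meas(2) by simp
    show "X n \<in> borel_measurable lborel" for n
      unfolding X_def using meas(1) by measurable
    show "AE x in lborel. (\<lambda>n. X n x) \<longlonglongrightarrow> ?d x"
    proof (intro AE_I2)
      fix x
      have "((\<lambda>s. (\<phi> (x + s *\<^sub>R b) - \<phi> x) / s) \<longlongrightarrow> ?d x) (at 0)"
        using line[of x 0] by (simp add: DERIV_def)
      moreover have "filterlim h (at 0) sequentially"
        unfolding filterlim_at using h(1) LIMSEQ_inverse_real_of_nat
        by (auto simp: h_def)
      ultimately show "(\<lambda>n. X n x) \<longlonglongrightarrow> ?d x"
        unfolding X_def by (rule filterlim_compose)
    qed
    show "AE x in lborel. norm (X n x) \<le> C * indicator G x" for n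
    proof (intro AE_I2)
      fix x
      obtain t where t: "0 < t" "t < h n"
        "\<phi> (x + h n *\<^sub>R b) - \<phi> (x + 0 *\<^sub>R b) = (h n - 0) * ?d (x + t *\<^sub>R b)"
        using MVT2[OF h(1), of n "\<lambda>s. \<phi> (x + s *\<^sub>R b)" "\<lambda>s. ?d (x + s *\<^sub>R b)"] line by blast
      then have X: "X n x = ?d (x + t *\<^sub>R b)" using h(1)[of n] by (simp add: X_def)
      have "0 \<le> C" using C(1)[of x] by linarith
      show "norm (X n x) \<le> C * indicator G x"
      proof (cases "x + t *\<^sub>R b \<in> ?K")
        case True
        then show ?thesis using inG[OF True] t h(2)[of n] C(2) X by simp
      next
        case False
        then show ?thesis using facts(4)[OF False] X \<open>0 \<le> C\<close> by simp
      qed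
    qed
  qed
  then have "(LINT x|lborel. ?d x) = 0" using null by (simp add: LIMSEQ_const_iff)
  moreover have "(LINT x|lebesgue_on \<Omega>. ?d x) = (LINT x|lebesgue. ?d x)"
  proof -
    have "indicator \<Omega> x *\<^sub>R ?d x = ?d x" for x
      using facts(4)[of x] K(2) by (cases "x \<in> \<Omega>") auto
    then show ?thesis using \<Omega> by (subst integral_restrict_space) (simp_all only:, simp)
  qed
  moreover have "(LINT x|lebesgue. ?d x) = (LINT x|lborel. ?d x)"
    using meas(2) by (intro integral_completion) simp
  ultimately show ?thesis by simp
qed

lemma const_H1:
  fixes \<Omega> :: "'a::euclidean_space set"
  assumes \<Omega>: "open \<Omega>" "bounded \<Omega>"
  shows "(\<lambda>x. c) \<in> H1 \<Omega>" and "AE x in lebesgue_on \<Omega>. weak_gradient \<Omega> (\<lambda>x. c) x = 0"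
proof -
  interpret finite_measure "lebesgue_on \<Omega>" by (rule finite_measure_bounded_domain[OF \<Omega>])
  have L: "(\<lambda>x. k) \<in> L2 \<Omega>" for k :: "'c::euclidean_space" by (simp add: L2_def)
  have w: "has_weak_gradient \<Omega> (\<lambda>x. c) (\<lambda>x. 0)"
    using integral_test_derivative_zero[OF \<Omega>(1)] by (simp add: has_weak_gradient_def)
  show H: "(\<lambda>x. c) \<in> H1 \<Omega>" using L[of c] L[of "0::'a"] w unfolding H1_def by blast
  show "AE x in lebesgue_on \<Omega>. weak_gradient \<Omega> (\<lambda>x. c) x = 0"
    by (rule weak_gradient_unique[OF \<Omega> weak_gradient_spec[OF H] L w])
qed

text \<open>
  Constants are admissible test functions that the diffusion term does not see; this is the source
  of mass conservation.
\<close>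

lemma A_form_const:
  fixes \<Omega> :: "'a::euclidean_space set"
  assumes \<Omega>: "open \<Omega>" "bounded \<Omega>" 
  shows "A_form \<Omega> a q (\<lambda>x. c) = 0"
proof -
  have "AE x in lebesgue_on \<Omega>. a x * (weak_gradient \<Omega> q x \<bullet> weak_gradient \<Omega> (\<lambda>x. c) x) = 0"
    using const_H1(2)[OF \<Omega>, of c] by eventually_elim simp
  then show ?thesis unfolding A_form_def by (rule integral_eq_zero_AE)
qed

section \<open>The forms of the scheme\<close>

lemma A_form_psd:
  fixes \<Omega> :: "'a::euclidean_space set"
  assumes \<Omega>: "open \<Omega>" "bounded \<Omega>" and V: "V \<subseteq> H1 \<Omega>"
    and a: "a \<in> C0 \<Omega>" "\<And>x. x \<in> closure \<Omega> \<Longrightarrow> a x \<ge> 0"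
  shows "psd_form (closure \<Omega>) V (A_form \<Omega> a)"
  unfolding psd_form_def
proof (intro ballI conjI)
  fix q assume q: "q \<in> V"
  obtain C where C: "\<And>x. x \<in> closure \<Omega> \<Longrightarrow> \<bar>a x\<bar> \<le> C" using C0_bounded[OF \<Omega>(2) a(1)] by blast
  have sub: "\<Omega> \<subseteq> closure \<Omega>" by (rule closure_subset)
  have int: "integrable (lebesgue_on \<Omega>) (\<lambda>x. a x * (weak_gradient \<Omega> q x \<bullet> weak_gradient \<Omega> v x))"
    if "v \<in> V" for v
    by (rule L2_integrable_mult[OF weak_gradient_spec(1) weak_gradient_spec(1) C0_measurable[OF \<Omega>(1) a(1)]])
      (use q that V C sub in auto)
  show "lin_on (closure \<Omega>) V (A_form \<Omega> a q)"
    unfolding lin_on_def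
  proof (intro ballI allI impI)
    fix p v z c assume pv: "p \<in> V" "v \<in> V" "z \<in> V" and eq: "\<forall>x\<in>closure \<Omega>. z x = p x + c * v x"
    let ?g = "weak_gradient \<Omega>"
    have "AE x in lebesgue_on \<Omega>. ?g z x = ?g p x + c *\<^sub>R ?g v x"
      by (rule H1_comb(2)[OF \<Omega>]) (use pv V eq sub in auto)
    then have ae: "AE x in lebesgue_on \<Omega>. a x * (?g q x \<bullet> ?g z x)
        = a x * (?g q x \<bullet> ?g p x) + c * (a x * (?g q x \<bullet> ?g v x))"
      by eventually_elim (simp add: inner_add_right algebra_simps)
    have "A_form \<Omega> a q z = (LINT x|lebesgue_on \<Omega>. a x * (?g q x \<bullet> ?g p x) + c * (a x * (?g q x \<bullet> ?g v x)))"
      unfolding A_form_def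
      by (rule integral_cong_AE[OF _ _ ae]) (use int pv in \<open>auto intro!: borel_measurable_integrable\<close>)
    then show "A_form \<Omega> a q z = A_form \<Omega> a q p + c * A_form \<Omega> a q v"
      using int[OF pv(1)] int[OF pv(2)] by (simp add: A_form_def)
  qed
  show "A_form \<Omega> a q q \<ge> 0"
    unfolding A_form_def using a(2) sub
    by (intro Bochner_Integration.integral_nonneg) (auto simp: space_restrict_space)
  show "A_form \<Omega> a q v = A_form \<Omega> a v q" for v
    by (simp add: A_form_def inner_commute)
qed

lemma L2_inner_lin_on:
  assumes \<Omega>: "open \<Omega>" and V: "V \<subseteq> L2 \<Omega>" and f: "f \<in> L2 \<Omega>"
  shows "lin_on (closure \<Omega>) V (L2_inner \<Omega> f)"
  unfolding lin_on_def
proof (intro ballI allI impI)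
  fix p v z c assume pv: "p \<in> V" "v \<in> V" "z \<in> V" and eq: "\<forall>x\<in>closure \<Omega>. z x = p x + c * v x"
  have int: "integrable (lebesgue_on \<Omega>) (\<lambda>x. f x * v x)" if "v \<in> V" for v
    using L2_integrable_mult[OF f, of v "\<lambda>x. 1" 1] that V by auto
  have "L2_inner \<Omega> f z = (LINT x|lebesgue_on \<Omega>. f x * p x + c * (f x * v x))"
    unfolding L2_inner_def using eq closure_subset[of \<Omega>]
    by (intro Bochner_Integration.integral_cong) (auto simp: space_restrict_space algebra_simps)
  then show "L2_inner \<Omega> f z = L2_inner \<Omega> f p + c * L2_inner \<Omega> f v"
    using int[OF pv(1)] int[OF pv(2)] by (simp add: L2_inner_def)
qed

lemma weighted_L2_psd:
  fixes \<Omega> :: "'a::euclidean_space set"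
  assumes \<Omega>: "open \<Omega>" "bounded \<Omega>" and V: "V \<subseteq> C0 \<Omega>"
    and a: "a \<in> C0 \<Omega>" "\<And>x. x \<in> closure \<Omega> \<Longrightarrow> a x \<ge> 0"
  shows "psd_form (closure \<Omega>) V (\<lambda>q. L2_inner \<Omega> (\<lambda>x. a x * q x))"
  unfolding psd_form_def
proof (intro ballI conjI)
  fix q assume q: "q \<in> V"
  show "lin_on (closure \<Omega>) V (L2_inner \<Omega> (\<lambda>x. a x * q x))"
    using V q by (intro L2_inner_lin_on[OF \<Omega>(1)] C0_L2[OF \<Omega>] C0_mult a) (auto intro: C0_L2[OF \<Omega>])
  show "L2_inner \<Omega> (\<lambda>x. a x * q x) q \<ge> 0"
    unfolding L2_inner_def using a(2) closure_subset[of \<Omega>]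
    by (intro Bochner_Integration.integral_nonneg) (auto simp: space_restrict_space mult.assoc)
  show "L2_inner \<Omega> (\<lambda>x. a x * q x) v = L2_inner \<Omega> (\<lambda>x. a x * v x) q" for v
    by (simp add: L2_inner_def ac_simps)
qed

lemma L2_inner_definite:
  fixes \<Omega> :: "'a::euclidean_space set"
  assumes \<Omega>: "open \<Omega>" "bounded \<Omega>" and v: "v \<in> C0 \<Omega>" "L2_inner \<Omega> v v = 0"
  shows "\<forall>x\<in>closure \<Omega>. v x = 0"
proof -
  have "AE x in lebesgue_on \<Omega>. v x * v x = 0"
    using v C0_integrable[OF \<Omega> C0_mult[OF v(1) v(1)]]
    by (subst (asm) L2_inner_def, subst (asm) integral_nonneg_eq_0_iff_AE) auto
  then have ae: "AE x in lebesgue. x \<in> \<Omega> \<longrightarrow> x \<in> {x \<in> closure \<Omega>. v x = 0}"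
    using \<Omega>(1) closure_subset[of \<Omega>] by (auto simp: AE_restrict_space_iff elim!: eventually_mono)
  have "closed {x \<in> closure \<Omega>. v x = 0}"
    using v(1) by (intro continuous_closed_preimage_constant) (auto simp: C0_def)
  from mem_closed_if_AE_lebesgue_open[OF \<Omega>(1) this ae]
  have "v x = 0" if "x \<in> \<Omega>" for x using that by blast
  then show ?thesis
    using v(1) continuous_constant_on_closure[of \<Omega> v 0] by (auto simp: C0_def)
qed

section \<open>The finite element space\<close>

lemma poly_space_comb:
  assumes "p \<in> poly_space k" "q \<in> poly_space k"
  shows "(\<lambda>x. p x + c * q x) \<in> poly_space k"
proof -
  obtain c1 c2 where "p = (\<lambda>x. \<Sum>\<alpha> \<in> {\<alpha> \<in> Basis \<rightarrow>\<^sub>E {..k}. (\<Sum>b\<in>Basis. \<alpha> b) \<le> k}.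
        c1 \<alpha> * (\<Prod>b\<in>Basis. (x \<bullet> b) ^ \<alpha> b))"
    "q = (\<lambda>x. \<Sum>\<alpha> \<in> {\<alpha> \<in> Basis \<rightarrow>\<^sub>E {..k}. (\<Sum>b\<in>Basis. \<alpha> b) \<le> k}.
        c2 \<alpha> * (\<Prod>b\<in>Basis. (x \<bullet> b) ^ \<alpha> b))"
    using assms unfolding poly_space_def by auto
  then show ?thesis unfolding poly_space_def
    by (intro CollectI exI[of _ "\<lambda>\<alpha>. c1 \<alpha> + c * c2 \<alpha>"])
      (simp add: algebra_simps sum.distrib sum_distrib_left)
qed

lemma const_poly_space: "(\<lambda>x. c) \<in> poly_space k"
proof -
  let ?I = "{\<alpha> \<in> (Basis :: 'a set) \<rightarrow>\<^sub>E {..k}. (\<Sum>b\<in>Basis. \<alpha> b) \<le> k}"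
  let ?z = "\<lambda>b\<in>(Basis :: 'a set). (0::nat)"
  have fin: "finite ?I" by (rule finite_subset[OF _ finite_PiE[of Basis "\<lambda>_. {..k}"]]) auto
  have z: "?z \<in> ?I" by auto
  have "(\<Sum>\<alpha>\<in>?I. (if \<alpha> = ?z then c else 0) * (\<Prod>b\<in>Basis. (x \<bullet> b) ^ \<alpha> b)) = c" for x
  proof -
    have "(\<Sum>\<alpha>\<in>?I. (if \<alpha> = ?z then c else 0) * (\<Prod>b\<in>Basis. (x \<bullet> b) ^ \<alpha> b))
        = (\<Sum>\<alpha>\<in>?I. if \<alpha> = ?z then c * (\<Prod>b\<in>Basis. (x \<bullet> b) ^ ?z b) else 0)"
      by (intro sum.cong) auto
    also have "\<dots> = c * (\<Prod>b\<in>Basis. (x \<bullet> b) ^ ?z b)" using fin z by (simp only: sum.delta if_True)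
    also have "\<dots> = c" by simp
    finally show ?thesis .
  qed
  then show ?thesis unfolding poly_space_def
    by (intro CollectI exI[of _ "\<lambda>\<alpha>. if \<alpha> = ?z then c else 0"]) presburger
qed

lemma fe_space_comb:
  assumes \<Omega>: "open \<Omega>" "bounded \<Omega>" and cover: "\<Union>\<T> = closure \<Omega>"
    and q: "q \<in> fe_space \<Omega> \<T> k" and v: "v \<in> fe_space \<Omega> \<T> k"
    and z: "\<And>x. x \<in> closure \<Omega> \<Longrightarrow> z x = q x + c * v x"
  shows "z \<in> fe_space \<Omega> \<T> k"
proof -
  have "z \<in> C0 \<Omega>"
    by (rule C0_cong[OF _ C0_comb[of q _ v c]]) (use q v z in \<open>auto simp: fe_space_def\<close>)
  moreover have "z \<in> H1 \<Omega>"
    by (rule H1_comb(1)[OF \<Omega>, of q v _ c]) (use q v z closure_subset[of \<Omega>] in \<open>auto simp: fe_space_def\<close>)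
  moreover have "\<exists>p\<in>poly_space k. \<forall>x\<in>T. z x = p x" if T: "T \<in> \<T>" for T
  proof -
    obtain p1 p2 where p: "p1 \<in> poly_space k" "\<forall>x\<in>T. q x = p1 x" "p2 \<in> poly_space k" "\<forall>x\<in>T. v x = p2 x"
      using q v T unfolding fe_space_def by blast
    have "T \<subseteq> closure \<Omega>" using T cover by blast
    then show ?thesis using p z by (intro bexI[OF _ poly_space_comb[OF p(1,3), of c]]) auto
  qed
  ultimately show ?thesis by (simp add: fe_space_def)
qed

lemma fe_space_const:
  fixes \<Omega> :: "'a::euclidean_space set"
  assumes "open \<Omega>" "bounded \<Omega>"
  shows "(\<lambda>x. c) \<in> fe_space \<Omega> \<T> k"
proof -
  have "\<exists>p\<in>poly_space k. \<forall>x\<in>T. c = p x" for T :: "'a set"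
    by (rule bexI[OF _ const_poly_space[of c k]]) simp
  then show ?thesis using const_H1(1)[OF assms, of c] C0_const[of c \<Omega>] by (simp add: fe_space_def)
qed

lemma fe_space_fun_space:
  assumes "open \<Omega>" "bounded \<Omega>" "\<Union>\<T> = closure \<Omega>"
  shows "fun_space (fe_space \<Omega> \<T> k)"
  unfolding fun_space_def
proof (intro conjI ballI allI)
  show "(\<lambda>x. 0) \<in> fe_space \<Omega> \<T> k" by (rule fe_space_const[OF assms(1,2)])
  show "(\<lambda>x. q x + c * v x) \<in> fe_space \<Omega> \<T> k"
    if "q \<in> fe_space \<Omega> \<T> k" "v \<in> fe_space \<Omega> \<T> k" for q v c
    by (rule fe_space_comb[OF assms that, of _ c]) simp
qed

text \<open>
  An element of the space is described on \<open>closure \<Omega>\<close> by its polynomial coefficients on the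
  finitely many cells. The coefficient vectors that occur form a subspace of a finite-dimensional
  space, and a spanning set of that subspace yields the family \<open>e\<close>, indexed by the vectors.
  Off \<open>closure \<Omega>\<close> the elements are arbitrary, so the representation can only hold there.
\<close>

lemma fe_space_finite_span:
  fixes \<Omega> :: "'a::euclidean_space set"
  assumes \<Omega>: "open \<Omega>" "bounded \<Omega>" and \<T>: "finite \<T>" "\<Union>\<T> = closure \<Omega>"
  obtains P :: "('a set \<times> ('a \<Rightarrow> nat) \<Rightarrow> real) set" and e
  where "finite P" "\<And>i. e i \<in> fe_space \<Omega> \<T> k"
    "\<And>v. v \<in> fe_space \<Omega> \<T> k \<Longrightarrow> \<exists>c. \<forall>x\<in>closure \<Omega>. v x = (\<Sum>i\<in>P. c i * e i x)"
proof -
  let ?V = "fe_space \<Omega> \<T> k"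
  let ?I = "{\<alpha> \<in> (Basis :: 'a set) \<rightarrow>\<^sub>E {..k}. (\<Sum>b\<in>Basis. \<alpha> b) \<le> k}"
  let ?mon = "\<lambda>\<alpha> x. \<Prod>b\<in>Basis. (x \<bullet> b :: real) ^ \<alpha> b"
  define rep where "rep = (\<lambda>s v. v \<in> ?V \<and> (\<forall>T\<in>\<T>. \<forall>x\<in>T. v x = (\<Sum>\<alpha>\<in>?I. s (T, \<alpha>) * ?mon \<alpha> x)))"
  define S where "S = {s. \<exists>v. rep s v}"
  have fin: "finite ?I" by (rule finite_subset[OF _ finite_PiE[of Basis "\<lambda>_. {..k}"]]) auto
  have ex: "\<exists>s. rep s v" if v: "v \<in> ?V" for v
  proof -
    have "\<forall>T\<in>\<T>. \<exists>c. \<forall>x\<in>T. v x = (\<Sum>\<alpha>\<in>?I. c \<alpha> * ?mon \<alpha> x)"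
    proof
      fix T assume "T \<in> \<T>"
      then obtain p where "p \<in> poly_space k" "\<forall>x\<in>T. v x = p x"
        using v unfolding fe_space_def by blast
      then show "\<exists>c. \<forall>x\<in>T. v x = (\<Sum>\<alpha>\<in>?I. c \<alpha> * ?mon \<alpha> x)"
        unfolding poly_space_def by auto
    qed
    then obtain c where "\<forall>T\<in>\<T>. \<forall>x\<in>T. v x = (\<Sum>\<alpha>\<in>?I. c T \<alpha> * ?mon \<alpha> x)"
      by (rule bchoice[THEN exE])
    then have "rep (\<lambda>(T, \<alpha>). c T \<alpha>) v" using v by (simp add: rep_def)
    then show ?thesis by blast
  qed
  have S: "(\<lambda>j. p j + c * q j) \<in> S" if pq: "p \<in> S" "q \<in> S" for p q c
  proof -
    obtain u v where uv: "rep p u" "rep q v" using pq by (auto simp: S_def)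
    have "(\<lambda>x. u x + c * v x) \<in> ?V"
      by (rule fe_space_comb[OF \<Omega> \<T>(2), of u _ v _ c]) (use uv in \<open>auto simp: rep_def\<close>)
    then have "rep (\<lambda>j. p j + c * q j) (\<lambda>x. u x + c * v x)"
      using uv by (simp add: rep_def algebra_simps sum.distrib sum_distrib_left)
    then show ?thesis by (auto simp: S_def)
  qed
  have "\<exists>P. finite P \<and> P \<subseteq> S \<and> (\<forall>s\<in>S. \<exists>c. \<forall>j\<in>\<T> \<times> ?I. s j = (\<Sum>p\<in>P. c p * p j))"
    by (rule finite_spanning_subset[OF finite_cartesian_product[OF \<T>(1) fin] S])
  then obtain P where P: "finite P" "P \<subseteq> S"
    "\<forall>s\<in>S. \<exists>c. \<forall>j\<in>\<T> \<times> ?I. s j = (\<Sum>p\<in>P. c p * p j)" by blast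
  define e where "e = (\<lambda>p. if p \<in> P then SOME v. rep p v else (\<lambda>x. 0))"
  have e: "rep p (e p)" if "p \<in> P" for p
    using that P(2) someI_ex[of "rep p"] by (auto simp: e_def S_def)
  show thesis
  proof (rule that[OF P(1)])
    show "e i \<in> ?V" for i
      using e[of i] fe_space_const[OF \<Omega>] by (cases "i \<in> P") (auto simp: rep_def e_def)
    fix v assume "v \<in> ?V"
    then obtain s where s: "rep s v" using ex by blast
    then have "s \<in> S" by (auto simp: S_def)
    then obtain c where c: "\<forall>j\<in>\<T> \<times> ?I. s j = (\<Sum>p\<in>P. c p * p j)" using P(3) by blast
    have "v x = (\<Sum>p\<in>P. c p * e p x)" if "x \<in> closure \<Omega>" for x
    proof -
      obtain T where T: "T \<in> \<T>" "x \<in> T" using \<T>(2) \<open>x \<in> closure \<Omega>\<close> by blast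
      have "v x = (\<Sum>\<alpha>\<in>?I. s (T, \<alpha>) * ?mon \<alpha> x)" using s T by (auto simp: rep_def)
      also have "\<dots> = (\<Sum>\<alpha>\<in>?I. (\<Sum>p\<in>P. c p * p (T, \<alpha>)) * ?mon \<alpha> x)"
        using c T(1) by (intro sum.cong) auto
      also have "\<dots> = (\<Sum>\<alpha>\<in>?I. \<Sum>p\<in>P. c p * (p (T, \<alpha>) * ?mon \<alpha> x))"
        by (simp add: sum_distrib_right mult.assoc)
      also have "\<dots> = (\<Sum>p\<in>P. \<Sum>\<alpha>\<in>?I. c p * (p (T, \<alpha>) * ?mon \<alpha> x))"
        by (rule sum.swap)
      also have "\<dots> = (\<Sum>p\<in>P. c p * (\<Sum>\<alpha>\<in>?I. p (T, \<alpha>) * ?mon \<alpha> x))"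
        by (simp add: sum_distrib_left)
      also have "\<dots> = (\<Sum>p\<in>P. c p * e p x)"
        using e T by (intro sum.cong) (auto simp: rep_def)
      finally show ?thesis .
    qed
    then show "\<exists>c. \<forall>x\<in>closure \<Omega>. v x = (\<Sum>i\<in>P. c i * e i x)" by blast
  qed
qed

section \<open>The two-step time discretization\<close>

lemma extrap_in: "fun_space V \<Longrightarrow> p \<in> V \<Longrightarrow> q \<in> V \<Longrightarrow> extrap p q \<in> V"
  using fun_space_comb3[of V p q q "-1" 2 0] by (simp add: extrap_def)

lemma bdf2_in: "fun_space V \<Longrightarrow> p \<in> V \<Longrightarrow> q \<in> V \<Longrightarrow> r \<in> V \<Longrightarrow> bdf2 \<tau> p q r \<in> V"
  using fun_space_comb3[of V p q r "1 / (2 * \<tau>)" "- 4 / (2 * \<tau>)" "3 / (2 * \<tau>)"]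
  by (simp add: bdf2_def diff_divide_distrib add_divide_distrib algebra_simps)

text \<open>
  The G-stability of the two-step backward differentiation formula. For real numbers this is
  \<open>2 r (3 r - 4 q + p) = r\<^sup>2 + (2 r - q)\<^sup>2 - q\<^sup>2 - (2 q - p)\<^sup>2 + (r - 2 q + p)\<^sup>2\<close>;
  expanding both sides by bilinearity and symmetry transfers it to \<open>b\<close>.
\<close>

lemma bdf2_identity:
  assumes V: "fun_space V" and b: "psd_form K V b" and mem: "p \<in> V" "q \<in> V" "r \<in> V" and \<tau>: "\<tau> \<noteq> 0"
  shows "4 * \<tau> * b r (bdf2 \<tau> p q r) =
    b r r + b (extrap q r) (extrap q r) - b q q - b (extrap p q) (extrap p q)
      + b (\<lambda>x. r x - extrap p q x) (\<lambda>x. r x - extrap p q x)"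
proof -
  have s: "(\<lambda>x. r x - extrap p q x) \<in> V"
    using fun_space_comb3[OF V mem, of 1 "-2" 1] by (simp add: extrap_def algebra_simps)
  note in_V = extrap_in[OF V mem(1,2)] extrap_in[OF V mem(2,3)] bdf2_in[OF V mem, of \<tau>] s
  note comb = psd_form_comb3[OF V b mem]
  have left: "b (extrap p q) y = - b p y + 2 * b q y"
    "b (extrap q r) y = - b q y + 2 * b r y"
    "b (bdf2 \<tau> p q r) y = (b p y - 4 * b q y + 3 * b r y) / (2 * \<tau>)"
    "b (\<lambda>x. r x - extrap p q x) y = b p y - 2 * b q y + b r y" if y: "y \<in> V" for y
    using comb[OF in_V(1) y, of "-1" 2 0] comb[OF in_V(2) y, of 0 "-1" 2]
      comb[OF in_V(3) y, of "1 / (2 * \<tau>)" "- 4 / (2 * \<tau>)" "3 / (2 * \<tau>)"] comb[OF in_V(4) y, of 1 "-2" 1]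
    by (simp_all add: extrap_def bdf2_def diff_divide_distrib add_divide_distrib algebra_simps)
  have sym: "b y z = b z y" if "y \<in> V" "z \<in> V" for y z
    using psd_form_D(3)[OF b that(1)] that(2) by blast
  have right: "b y (extrap p q) = - b y p + 2 * b y q"
    "b y (extrap q r) = - b y q + 2 * b y r"
    "b y (bdf2 \<tau> p q r) = (b y p - 4 * b y q + 3 * b y r) / (2 * \<tau>)"
    "b y (\<lambda>x. r x - extrap p q x) = b y p - 2 * b y q + b y r" if y: "y \<in> V" for y
    using left[OF y] sym[OF _ y] in_V mem by simp_all
  show ?thesis
    using \<tau> by (simp add: left right in_V mem sym[of q p] sym[of r p] sym[of r q] field_simps)
qed

lemma C0_fun_space: "fun_space (C0 \<Omega>)"
  by (auto simp: fun_space_def C0_const C0_comb)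

lemma L2_inner_psd:
  fixes \<Omega> :: "'a::euclidean_space set"
  assumes "open \<Omega>" "bounded \<Omega>" "V \<subseteq> C0 \<Omega>"
  shows "psd_form (closure \<Omega>) V (L2_inner \<Omega>)"
  using weighted_L2_psd[OF assms C0_const[of 1]] by simp

lemma L2_inner_cong:
  "(\<And>x. x \<in> \<Omega> \<Longrightarrow> f x * g x = f' x * g' x) \<Longrightarrow> L2_inner \<Omega> f g = L2_inner \<Omega> f' g'"
  unfolding L2_inner_def by (intro Bochner_Integration.integral_cong) (auto simp: space_restrict_space)

lemma fe_space_sub: "fe_space \<Omega> \<T> k \<subseteq> H1 \<Omega>" "fe_space \<Omega> \<T> k \<subseteq> C0 \<Omega>"
  by (auto simp: fe_space_def)

lemma fe_space_cong:
  assumes "open \<Omega>" "bounded \<Omega>" "\<Union>\<T> = closure \<Omega>" "v \<in> fe_space \<Omega> \<T> k"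
    "\<And>x. x \<in> closure \<Omega> \<Longrightarrow> z x = v x"
  shows "z \<in> fe_space \<Omega> \<T> k"
  by (rule fe_space_comb[OF assms(1-4,4), of _ 0]) (simp add: assms(5))

text \<open>
  Existence of the projection is the special case \<open>a = 0\<close>, \<open>d = 0\<close> of \<open>saddle_exists\<close>.
\<close>

lemma L2_proj_mem:
  fixes \<Omega> :: "'a::euclidean_space set"
  assumes \<Omega>: "open \<Omega>" "bounded \<Omega>" and \<T>: "finite \<T>" "\<Union>\<T> = closure \<Omega>" and f: "f \<in> L2 \<Omega>"
  shows "L2_proj \<Omega> (fe_space \<Omega> \<T> k) f \<in> fe_space \<Omega> \<T> k"
proof -
  let ?V = "fe_space \<Omega> \<T> k"
  have V: "fun_space ?V" by (rule fe_space_fun_space[OF \<Omega> \<T>(2)])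
  have VL: "?V \<subseteq> L2 \<Omega>" using fe_space_sub(2) C0_L2[OF \<Omega>] by blast
  obtain P :: "('a set \<times> ('a \<Rightarrow> nat) \<Rightarrow> real) set" and e
    where P: "finite P" "\<And>i. e i \<in> ?V"
      "\<And>v. v \<in> ?V \<Longrightarrow> \<exists>c. \<forall>x\<in>closure \<Omega>. v x = (\<Sum>i\<in>P. c i * e i x)"
    using fe_space_finite_span[OF \<Omega> \<T>] by blast
  have "\<exists>u\<in>?V. \<exists>w\<in>?V. \<forall>\<phi>\<in>?V. L2_inner \<Omega> u \<phi> + 0 = L2_inner \<Omega> f \<phi> \<and> L2_inner \<Omega> w \<phi> - 0 = 0"
  proof (rule saddle_exists[OF V L2_inner_psd[OF \<Omega> fe_space_sub(2)] psd_form_zero psd_form_zero _ P])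
    show "lin_on (closure \<Omega>) ?V (L2_inner \<Omega> f)" by (rule L2_inner_lin_on[OF \<Omega>(1) VL f])
    show "\<forall>x\<in>closure \<Omega>. v x = 0" if "v \<in> ?V" "L2_inner \<Omega> v v = 0" for v
      using L2_inner_definite[OF \<Omega>] that fe_space_sub(2) by blast
  qed (auto simp: lin_on_def)
  then obtain u where u: "u \<in> ?V" "\<forall>\<phi>\<in>?V. L2_inner \<Omega> u \<phi> = L2_inner \<Omega> f \<phi>" by auto
  have "L2_inner \<Omega> (\<lambda>x. f x - u x) \<phi> = 0" if \<phi>: "\<phi> \<in> ?V" for \<phi>
  proof -
    have int: "integrable (lebesgue_on \<Omega>) (\<lambda>x. g x * \<phi> x)" if "g \<in> L2 \<Omega>" for g :: "'a \<Rightarrow> real"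
      using L2_integrable_mult[OF that, of \<phi> "\<lambda>x. 1" 1] \<phi> VL by auto
    have "L2_inner \<Omega> (\<lambda>x. f x - u x) \<phi> = L2_inner \<Omega> f \<phi> - L2_inner \<Omega> u \<phi>"
      using int[OF f] int[of u] u(1) VL by (auto simp: L2_inner_def left_diff_distrib)
    then show ?thesis using u(2) \<phi> by simp
  qed
  then have "\<exists>v. v \<in> ?V \<and> (\<forall>\<phi>\<in>?V. L2_inner \<Omega> (\<lambda>x. f x - v x) \<phi> = 0)" using u(1) by blast
  from someI_ex[OF this] show ?thesis by (simp add: L2_proj_def)
qed

text \<open>
  The third equation determines the new \<open>U\<close> pointwise from the new \<open>u\<close>. Inserting it into the
  second one produces the additional positive semidefinite term \<open>1/2 (h\<^sup>2 v, \<phi>)\<close>; multiplying the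
  first by \<open>2 \<tau> / 3\<close> brings the pair into the form treated by \<open>saddle_exists\<close>. The summand \<open>0\<close>
  is present because the scaled form is built by \<open>psd_form_add\<close> from the zero form.
\<close>

lemma scheme_step_iff_saddle:
  fixes \<Omega> :: "'a::euclidean_space set"
  assumes \<Omega>: "open \<Omega>" "bounded \<Omega>" and V: "V \<subseteq> C0 \<Omega>" and \<tau>: "\<tau> > 0"
    and old: "u\<^sub>o \<in> V" "u \<in> V" "U\<^sub>o \<in> C0 \<Omega>" "U \<in> C0 \<Omega>"
    and h: "h \<in> C0 \<Omega>" and h_def: "h = (\<lambda>x. H (extrap u\<^sub>o u x))"
    and p_def: "p = (\<lambda>x. (4 * u x - u\<^sub>o x) / 3)" and G_def: "G = (\<lambda>x. (4 * U x - U\<^sub>o x) / 3)"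
  shows "scheme_step \<Omega> V \<epsilon> \<tau> H M u\<^sub>o u U\<^sub>o U v z Z \<longleftrightarrow>
    v \<in> V \<and> z \<in> V \<and> Z \<in> C0 \<Omega> \<and>
    (\<forall>\<phi>\<in>V. L2_inner \<Omega> v \<phi> + (0 + (2 * \<tau> / 3) * A_form \<Omega> (\<lambda>x. M (extrap u\<^sub>o u x)) z \<phi>) = L2_inner \<Omega> p \<phi> \<and>
      L2_inner \<Omega> z \<phi> - (A_form \<Omega> (\<lambda>_. \<epsilon>\<^sup>2) v \<phi> + 1/2 * L2_inner \<Omega> (\<lambda>x. (h x * h x) * v x) \<phi>)
        = L2_inner \<Omega> (\<lambda>x. h x * (G x - 1/2 * h x * p x)) \<phi>) \<and>
    (\<forall>x\<in>closure \<Omega>. Z x = G x + 1/2 * h x * (v x - p x))"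
proof -
  note psd = L2_inner_psd[OF \<Omega> order_refl]
  have C: "u\<^sub>o \<in> C0 \<Omega>" "u \<in> C0 \<Omega>" using old V by auto
  have pC: "p \<in> C0 \<Omega>" "G \<in> C0 \<Omega>"
    using C old by (auto simp: p_def G_def C0_def intro!: continuous_intros)
  have bdf: "bdf2 \<tau> u\<^sub>o u v x = 3 / (2 * \<tau>) * (v x - p x)" "bdf2 \<tau> U\<^sub>o U Z x = 3 / (2 * \<tau>) * (Z x - G x)"
    for v Z x using \<tau> by (simp_all add: bdf2_def p_def G_def field_simps)
  have third: "(bdf2 \<tau> U\<^sub>o U Z x = 1/2 * H (extrap u\<^sub>o u x) * bdf2 \<tau> u\<^sub>o u v x) \<longleftrightarrow>
      Z x = G x + 1/2 * h x * (v x - p x)" for x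
  proof -
    have "(bdf2 \<tau> U\<^sub>o U Z x = 1/2 * H (extrap u\<^sub>o u x) * bdf2 \<tau> u\<^sub>o u v x) \<longleftrightarrow>
        3 / (2 * \<tau>) * (Z x - G x) = 3 / (2 * \<tau>) * (1/2 * h x * (v x - p x))"
      by (simp only: bdf h_def mult_ac)
    also have "\<dots> \<longleftrightarrow> Z x - G x = 1/2 * h x * (v x - p x)"
      using \<tau> by (intro mult_left_cancel) auto
    finally show ?thesis by (simp only: diff_eq_eq add.commute)
  qed
  have first: "L2_inner \<Omega> (bdf2 \<tau> u\<^sub>o u v) \<phi> = 3 / (2 * \<tau>) * (L2_inner \<Omega> v \<phi> - L2_inner \<Omega> p \<phi>)"
    if "v \<in> V" "\<phi> \<in> V" for v \<phi>
  proof -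
    have "L2_inner \<Omega> (bdf2 \<tau> u\<^sub>o u v) \<phi> =
        3 / (2 * \<tau>) * L2_inner \<Omega> v \<phi> + (- 3 / (2 * \<tau>)) * L2_inner \<Omega> p \<phi> + 0 * L2_inner \<Omega> p \<phi>"
      by (rule psd_form_comb3[OF C0_fun_space psd])
        (use that V C pC bdf2_in[OF C0_fun_space C, of v \<tau>] in \<open>auto simp: bdf right_diff_distrib\<close>)
    then show ?thesis by (simp add: right_diff_distrib)
  qed
  have second: "L2_inner \<Omega> (\<lambda>x. H (extrap u\<^sub>o u x) * Z x) \<phi> =
      L2_inner \<Omega> (\<lambda>x. h x * (G x - 1/2 * h x * p x)) \<phi> + 1/2 * L2_inner \<Omega> (\<lambda>x. (h x * h x) * v x) \<phi>"
    if "v \<in> V" "\<phi> \<in> V" and Z: "Z \<in> C0 \<Omega>" "\<forall>x\<in>closure \<Omega>. Z x = G x + 1/2 * h x * (v x - p x)"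
    for \<phi>
  proof (rule psd_form_comb_left[OF psd])
    have vC: "v \<in> C0 \<Omega>" "\<phi> \<in> C0 \<Omega>" using that V by auto
    show "\<phi> \<in> C0 \<Omega>" by fact
    show "(\<lambda>x. h x * (G x - 1/2 * h x * p x)) \<in> C0 \<Omega>" "(\<lambda>x. (h x * h x) * v x) \<in> C0 \<Omega>"
      "(\<lambda>x. H (extrap u\<^sub>o u x) * Z x) \<in> C0 \<Omega>"
      using h pC vC Z(1) unfolding C0_def h_def by (auto intro!: continuous_intros)
    show "H (extrap u\<^sub>o u x) * Z x = h x * (G x - 1/2 * h x * p x) + 1/2 * ((h x * h x) * v x)"
      if "x \<in> closure \<Omega>" for x
    proof -
      have "H (extrap u\<^sub>o u x) = h x" "Z x = G x + 1/2 * h x * (v x - p x)"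
        using Z(2) that by (simp_all add: h_def)
      then show ?thesis by (simp only:) (simp add: field_simps)
    qed
  qed
  have eq1: "L2_inner \<Omega> (bdf2 \<tau> u\<^sub>o u v) \<phi> = - A \<longleftrightarrow> L2_inner \<Omega> v \<phi> + (0 + (2 * \<tau> / 3) * A) = L2_inner \<Omega> p \<phi>"
    if "v \<in> V" "\<phi> \<in> V" for \<phi> A
    using \<tau> by (simp add: first[OF that] field_simps)
  have eq2: "L2_inner \<Omega> z \<phi> = A + L2_inner \<Omega> (\<lambda>x. H (extrap u\<^sub>o u x) * Z x) \<phi> \<longleftrightarrow>
      L2_inner \<Omega> z \<phi> - (A + 1/2 * L2_inner \<Omega> (\<lambda>x. (h x * h x) * v x) \<phi>)
        = L2_inner \<Omega> (\<lambda>x. h x * (G x - 1/2 * h x * p x)) \<phi>"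
    if "v \<in> V" "\<phi> \<in> V" "Z \<in> C0 \<Omega>" "\<forall>x\<in>closure \<Omega>. Z x = G x + 1/2 * h x * (v x - p x)" for \<phi> A
    unfolding second[OF that] by argo
  show ?thesis
  proof (cases "v \<in> V \<and> z \<in> V \<and> Z \<in> C0 \<Omega> \<and>
      (\<forall>x\<in>closure \<Omega>. Z x = G x + 1/2 * h x * (v x - p x))")
    case True
    then have mem: "v \<in> V" "Z \<in> C0 \<Omega>"
      and Z: "\<forall>x\<in>closure \<Omega>. Z x = G x + 1/2 * h x * (v x - p x)" by auto
    show ?thesis unfolding scheme_step_def third
      by (simp only: eq1[OF mem(1)] eq2[OF mem(1) _ mem(2) Z] ball_conj_distrib conj_assoc cong: ball_cong)
  next
    case False
    then show ?thesis unfolding scheme_step_def third by blast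
  qed
qed

lemma scheme_step_unique_solution:
  fixes \<Omega> :: "'a::euclidean_space set"
  assumes \<Omega>: "open \<Omega>" "bounded \<Omega>" and \<T>: "finite \<T>" "\<Union>\<T> = closure \<Omega>" and \<tau>: "\<tau> > 0"
    and old: "u\<^sub>o \<in> fe_space \<Omega> \<T> k" "u \<in> fe_space \<Omega> \<T> k" "U\<^sub>o \<in> C0 \<Omega>" "U \<in> C0 \<Omega>"
    and h: "(\<lambda>x. H (extrap u\<^sub>o u x)) \<in> C0 \<Omega>"
    and \<mu>: "(\<lambda>x. M (extrap u\<^sub>o u x)) \<in> C0 \<Omega>" "\<And>x. x \<in> closure \<Omega> \<Longrightarrow> M (extrap u\<^sub>o u x) \<ge> 0"
  shows "\<exists>u\<^sub>n w\<^sub>n U\<^sub>n. scheme_step \<Omega> (fe_space \<Omega> \<T> k) \<epsilon> \<tau> H M u\<^sub>o u U\<^sub>o U u\<^sub>n w\<^sub>n U\<^sub>n \<and>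
    (\<forall>v z Z. scheme_step \<Omega> (fe_space \<Omega> \<T> k) \<epsilon> \<tau> H M u\<^sub>o u U\<^sub>o U v z Z \<longrightarrow>
       (\<forall>x\<in>closure \<Omega>. v x = u\<^sub>n x \<and> z x = w\<^sub>n x \<and> Z x = U\<^sub>n x))"
proof -
  let ?V = "fe_space \<Omega> \<T> k"
  define h where "h = (\<lambda>x. H (extrap u\<^sub>o u x))"
  define p where "p = (\<lambda>x. (4 * u x - u\<^sub>o x) / 3)"
  define G where "G = (\<lambda>x. (4 * U x - U\<^sub>o x) / 3)"
  define a where "a = (\<lambda>q v. A_form \<Omega> (\<lambda>_. \<epsilon>\<^sup>2) q v + 1/2 * L2_inner \<Omega> (\<lambda>x. (h x * h x) * q x) v)"
  define d where "d = (\<lambda>q v. 0 + (2 * \<tau> / 3) * A_form \<Omega> (\<lambda>x. M (extrap u\<^sub>o u x)) q v)"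
  define f where "f = L2_inner \<Omega> p"
  define g where "g = L2_inner \<Omega> (\<lambda>x. h x * (G x - 1/2 * h x * p x))"
  have hC: "h \<in> C0 \<Omega>" using h by (simp add: h_def)
  have step: "scheme_step \<Omega> ?V \<epsilon> \<tau> H M u\<^sub>o u U\<^sub>o U v z Z \<longleftrightarrow> v \<in> ?V \<and> z \<in> ?V \<and> Z \<in> C0 \<Omega> \<and>
      (\<forall>\<phi>\<in>?V. L2_inner \<Omega> v \<phi> + d z \<phi> = f \<phi> \<and> L2_inner \<Omega> z \<phi> - a v \<phi> = g \<phi>) \<and>
      (\<forall>x\<in>closure \<Omega>. Z x = G x + 1/2 * h x * (v x - p x))" for v z Z
    unfolding a_def d_def f_def g_def
    by (rule scheme_step_iff_saddle[OF \<Omega> fe_space_sub(2) \<tau> old hC h_def p_def G_def])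
  have C: "u\<^sub>o \<in> C0 \<Omega>" "u \<in> C0 \<Omega>" using old fe_space_sub(2) by auto
  have pC: "p \<in> C0 \<Omega>" "G \<in> C0 \<Omega>"
    using C old by (auto simp: p_def G_def C0_def intro!: continuous_intros)
  have V: "fun_space ?V" by (rule fe_space_fun_space[OF \<Omega> \<T>(2)])
  have VL: "?V \<subseteq> L2 \<Omega>" using fe_space_sub(2) C0_L2[OF \<Omega>] by blast
  have m: "psd_form (closure \<Omega>) ?V (L2_inner \<Omega>)" by (rule L2_inner_psd[OF \<Omega> fe_space_sub(2)])
  have a: "psd_form (closure \<Omega>) ?V a" unfolding a_def
    by (intro psd_form_add A_form_psd[OF \<Omega> fe_space_sub(1)] weighted_L2_psd[OF \<Omega> fe_space_sub(2)]
        C0_const C0_mult hC) auto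
  have d: "psd_form (closure \<Omega>) ?V d" unfolding d_def
    by (intro psd_form_add psd_form_zero A_form_psd[OF \<Omega> fe_space_sub(1)] \<mu>) (use \<tau> in auto)
  have def: "\<forall>x\<in>closure \<Omega>. v x = 0" if "v \<in> ?V" "L2_inner \<Omega> v v = 0" for v
    using L2_inner_definite[OF \<Omega>] that fe_space_sub(2) by blast
  have fl: "lin_on (closure \<Omega>) ?V f" unfolding f_def
    by (rule L2_inner_lin_on[OF \<Omega>(1) VL C0_L2[OF \<Omega> pC(1)]])
  have "(\<lambda>x. h x * (G x - 1/2 * h x * p x)) \<in> C0 \<Omega>"
    using hC pC by (auto simp: C0_def intro!: continuous_intros)
  then have gl: "lin_on (closure \<Omega>) ?V g" unfolding g_def
    by (intro L2_inner_lin_on[OF \<Omega>(1) VL] C0_L2[OF \<Omega>])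
  obtain P :: "('a set \<times> ('a \<Rightarrow> nat) \<Rightarrow> real) set" and e
    where P: "finite P" "\<And>i. e i \<in> ?V"
      "\<And>v. v \<in> ?V \<Longrightarrow> \<exists>c. \<forall>x\<in>closure \<Omega>. v x = (\<Sum>i\<in>P. c i * e i x)"
    using fe_space_finite_span[OF \<Omega> \<T>] by blast
  obtain u' w' where sol: "u' \<in> ?V" "w' \<in> ?V"
    "\<forall>\<phi>\<in>?V. L2_inner \<Omega> u' \<phi> + d w' \<phi> = f \<phi> \<and> L2_inner \<Omega> w' \<phi> - a u' \<phi> = g \<phi>"
    using saddle_exists[OF V m a d def P fl gl] by blast
  define U' where "U' = (\<lambda>x. G x + 1/2 * h x * (u' x - p x))"
  have "u' \<in> C0 \<Omega>" using sol(1) fe_space_sub(2) by blast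
  then have "U' \<in> C0 \<Omega>"
    using hC pC by (auto simp: U'_def C0_def intro!: continuous_intros)
  then have "scheme_step \<Omega> ?V \<epsilon> \<tau> H M u\<^sub>o u U\<^sub>o U u' w' U'"
    unfolding step using sol by (simp add: U'_def)
  moreover have "\<forall>x\<in>closure \<Omega>. v x = u' x \<and> z x = w' x \<and> Z x = U' x"
    if "scheme_step \<Omega> ?V \<epsilon> \<tau> H M u\<^sub>o u U\<^sub>o U v z Z" for v z Z
  proof -
    note vz = that[unfolded step]
    have "\<forall>x\<in>closure \<Omega>. v x = u' x \<and> z x = w' x"
      by (rule saddle_unique_solution[OF V m a d def sol]) (use vz in auto)
    then show ?thesis using vz by (simp add: U'_def)
  qed
  ultimately show ?thesis by blast
qed

lemma scheme_step_mass:
  fixes \<Omega> :: "'a::euclidean_space set"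
  assumes \<Omega>: "open \<Omega>" "bounded \<Omega>" and one: "(\<lambda>x. 1) \<in> V" and V: "V \<subseteq> C0 \<Omega>" and \<tau>: "\<tau> > 0"
    and old: "u\<^sub>o \<in> V" "u \<in> V"
    and step: "scheme_step \<Omega> V \<epsilon> \<tau> H M u\<^sub>o u U\<^sub>o U u\<^sub>n w\<^sub>n U\<^sub>n"
  shows "3 * (LINT x|lebesgue_on \<Omega>. u\<^sub>n x) = 4 * (LINT x|lebesgue_on \<Omega>. u x) - (LINT x|lebesgue_on \<Omega>. u\<^sub>o x)"
proof -
  have "u\<^sub>n \<in> V" using step by (simp add: scheme_step_def)
  then have int: "integrable (lebesgue_on \<Omega>) u\<^sub>o" "integrable (lebesgue_on \<Omega>) u" "integrable (lebesgue_on \<Omega>) u\<^sub>n"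
    using old V C0_integrable[OF \<Omega>] by auto
  have "L2_inner \<Omega> (bdf2 \<tau> u\<^sub>o u u\<^sub>n) (\<lambda>x. 1) = 0"
    using step one A_form_const[OF \<Omega>, of _ w\<^sub>n 1] by (simp add: scheme_step_def)
  then have "(LINT x|lebesgue_on \<Omega>. 3 * u\<^sub>n x - 4 * u x + u\<^sub>o x) = 0"
    using \<tau> by (simp add: L2_inner_def bdf2_def)
  then show ?thesis using int by simp
qed

text \<open>
  The first equation is tested with the new \<open>w\<close> and the second with the difference quotient of \<open>u\<close>.
  By the third equation \<open>H\<close> times that quotient is twice the difference quotient of \<open>U\<close>, so the
  nonlinear term turns quadratic as well, and \<open>bdf2_identity\<close> is applied to both inner products.
\<close>

lemma scheme_step_energy:
  fixes \<Omega> :: "'a::euclidean_space set"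
  assumes \<Omega>: "open \<Omega>" "bounded \<Omega>" and V: "fun_space V" "V \<subseteq> C0 \<Omega>" "V \<subseteq> H1 \<Omega>" and \<tau>: "\<tau> > 0"
    and old: "u\<^sub>o \<in> V" "u \<in> V" "U\<^sub>o \<in> C0 \<Omega>" "U \<in> C0 \<Omega>"
    and step: "scheme_step \<Omega> V \<epsilon> \<tau> H M u\<^sub>o u U\<^sub>o U u\<^sub>n w\<^sub>n U\<^sub>n"
  shows "1/2 * (energy \<Omega> \<epsilon> B u\<^sub>n U\<^sub>n + energy \<Omega> \<epsilon> B (extrap u u\<^sub>n) (extrap U U\<^sub>n)) =
    1/2 * (energy \<Omega> \<epsilon> B u U + energy \<Omega> \<epsilon> B (extrap u\<^sub>o u) (extrap U\<^sub>o U))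
    - \<tau> * A_form \<Omega> (\<lambda>x. M (extrap u\<^sub>o u x)) w\<^sub>n w\<^sub>n
    - 1/4 * A_form \<Omega> (\<lambda>_. \<epsilon>\<^sup>2) (\<lambda>x. u\<^sub>n x - extrap u\<^sub>o u x) (\<lambda>x. u\<^sub>n x - extrap u\<^sub>o u x)
    - 1/2 * (L2_norm \<Omega> (\<lambda>x. U\<^sub>n x - extrap U\<^sub>o U x))\<^sup>2"
proof -
  note s = step[unfolded scheme_step_def]
  have new: "u\<^sub>n \<in> V" "w\<^sub>n \<in> V" "U\<^sub>n \<in> C0 \<Omega>" using s by auto
  let ?D = "bdf2 \<tau> u\<^sub>o u u\<^sub>n" and ?DU = "bdf2 \<tau> U\<^sub>o U U\<^sub>n"
  have D: "?D \<in> V" by (rule bdf2_in[OF V(1) old(1,2) new(1)])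
  have "L2_inner \<Omega> ?D w\<^sub>n = - A_form \<Omega> (\<lambda>x. M (extrap u\<^sub>o u x)) w\<^sub>n w\<^sub>n" using s new by blast
  moreover have "L2_inner \<Omega> w\<^sub>n ?D =
      A_form \<Omega> (\<lambda>_. \<epsilon>\<^sup>2) u\<^sub>n ?D + L2_inner \<Omega> (\<lambda>x. H (extrap u\<^sub>o u x) * U\<^sub>n x) ?D" using s D by blast
  moreover have "L2_inner \<Omega> w\<^sub>n ?D = L2_inner \<Omega> ?D w\<^sub>n" by (simp add: L2_inner_def mult.commute)
  moreover have "L2_inner \<Omega> (\<lambda>x. H (extrap u\<^sub>o u x) * U\<^sub>n x) ?D = L2_inner \<Omega> U\<^sub>n (\<lambda>x. 2 * ?DU x)"
  proof (rule L2_inner_cong)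
    fix x assume "x \<in> \<Omega>"
    then have "?DU x = 1/2 * H (extrap u\<^sub>o u x) * ?D x" using s closure_subset[of \<Omega>] by blast
    then show "H (extrap u\<^sub>o u x) * U\<^sub>n x * ?D x = U\<^sub>n x * (2 * ?DU x)" by simp
  qed
  moreover have "L2_inner \<Omega> U\<^sub>n (\<lambda>x. 2 * ?DU x) = 2 * L2_inner \<Omega> U\<^sub>n ?DU"
  proof -
    have "(\<lambda>x. U\<^sub>n x * (2 * ?DU x)) = (\<lambda>x. 2 * (U\<^sub>n x * ?DU x))" by (simp add: fun_eq_iff)
    then show ?thesis unfolding L2_inner_def by simp
  qed
  ultimately have "A_form \<Omega> (\<lambda>x. M (extrap u\<^sub>o u x)) w\<^sub>n w\<^sub>n =
      - A_form \<Omega> (\<lambda>_. \<epsilon>\<^sup>2) u\<^sub>n ?D - 2 * L2_inner \<Omega> U\<^sub>n ?DU" by linarith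
  then have diss: "\<tau> * A_form \<Omega> (\<lambda>x. M (extrap u\<^sub>o u x)) w\<^sub>n w\<^sub>n =
      - (\<tau> * A_form \<Omega> (\<lambda>_. \<epsilon>\<^sup>2) u\<^sub>n ?D) - 2 * (\<tau> * L2_inner \<Omega> U\<^sub>n ?DU)"
    by (simp only: right_diff_distrib mult.left_commute[of \<tau> 2] mult_minus_right)
  have "4 * (\<tau> * b r (bdf2 \<tau> p q r)) =
      b r r + b (extrap q r) (extrap q r) - b q q - b (extrap p q) (extrap p q)
      + b (\<lambda>x. r x - extrap p q x) (\<lambda>x. r x - extrap p q x)"
    if "fun_space W" "psd_form (closure \<Omega>) W b" "p \<in> W" "q \<in> W" "r \<in> W" for W b p q r
    using bdf2_identity[OF that, of \<tau>] \<tau> by simp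
  note bdf = this[OF V(1) A_form_psd[OF \<Omega> V(3) C0_const[of "\<epsilon>\<^sup>2"] zero_le_power2] old(1,2) new(1)]
    this[OF C0_fun_space L2_inner_psd[OF \<Omega> order_refl] old(3,4) new(3)]
  have norm: "(L2_norm \<Omega> f)\<^sup>2 = L2_inner \<Omega> f f" for f
    unfolding L2_norm_def by (rule real_sqrt_pow2) (auto simp: L2_inner_def)
  have energy: "energy \<Omega> \<epsilon> B v W =
      1/2 * A_form \<Omega> (\<lambda>_. \<epsilon>\<^sup>2) v v + L2_inner \<Omega> W W - B * measure lebesgue \<Omega>" for v W
    by (simp add: energy_def L2_inner_def power2_eq_square)
  have arith: "1/2 * (1/2 * A1 + U1 - m + (1/2 * A2 + U2 - m)) =
      1/2 * (1/2 * A3 + U3 - m + (1/2 * A4 + U4 - m)) - d - 1/4 * A5 - 1/2 * U5"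
    if "d = - x - 2 * y" "4 * x = A1 + A2 - A3 - A4 + A5" "4 * y = U1 + U2 - U3 - U4 + U5"
    for A1 A2 A3 A4 A5 U1 U2 U3 U4 U5 m d x y :: real
    using that by (simp add: field_simps)
  show ?thesis unfolding energy norm by (rule arith[OF diss bdf])
qed

section \<open>Solvability, mass conservation and energy dissipation\<close>

lemma H_fun_continuous:
  assumes "\<And>s. s \<in> I \<Longrightarrow> (F has_real_derivative F' s) (at s within I)" "continuous_on I F'"
  shows "continuous_on (admissible_values I J F B) (H_fun F F' B)"
proof -
  have "continuous_on I F" using assms(1) by (rule DERIV_continuous_on)
  then have "continuous_on (admissible_values I J F B) F" "continuous_on (admissible_values I J F B) F'"
    using assms(2) by (auto simp: admissible_values_def intro: continuous_on_subset)
  then show ?thesis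
    unfolding H_fun_def by (intro continuous_intros) (auto simp: admissible_values_def)
qed

theorem theoremA1:
  fixes \<Omega> :: "'a::euclidean_space set" and \<T> :: "'a set set" and \<sigma> \<epsilon> \<Delta>t B :: real
    and k :: nat and I J :: "real set" and F F' M :: "real \<Rightarrow> real" and u\<^sub>0 :: "'a \<Rightarrow> real"
  assumes dim: "DIM('a) = 2 \<or> DIM('a) = 3"
    and domain: "open \<Omega>" "connected \<Omega>" "bounded \<Omega>" "\<Omega> \<noteq> {}"
    and mesh: "\<sigma> > 0" "quasi_uniform_triangulation \<sigma> \<Omega> \<T>"
    and k: "k \<ge> 1" and eps: "\<epsilon> > 0" and dt: "\<Delta>t > 0" and B: "B \<ge> 0"
    and potential: "is_interval I" "\<And>s. s \<in> I \<Longrightarrow> (F has_real_derivative F' s) (at s within I)"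
      "continuous_on I F'"
    and mobility: "continuous_on J M" "\<And>s. s \<in> J \<Longrightarrow> M s \<ge> 0"
    and datum: "u\<^sub>0 \<in> L2 \<Omega>" "\<And>x. x \<in> closure \<Omega> \<Longrightarrow> u\<^sub>0 x \<in> I \<and> F (u\<^sub>0 x) + B > 0"
      "(\<lambda>x. sqrt (F (u\<^sub>0 x) + B)) \<in> C0 \<Omega>"
  shows
    "(\<forall>u\<^sub>o \<in> fe_space \<Omega> \<T> k. \<forall>u \<in> fe_space \<Omega> \<T> k. \<forall>U\<^sub>o \<in> C0 \<Omega>. \<forall>U \<in> C0 \<Omega>.
        (\<forall>x\<in>closure \<Omega>. extrap u\<^sub>o u x \<in> admissible_values I J F B) \<longrightarrow>
        (\<exists>u\<^sub>n w\<^sub>n U\<^sub>n.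
           scheme_step \<Omega> (fe_space \<Omega> \<T> k) \<epsilon> \<Delta>t (H_fun F F' B) M u\<^sub>o u U\<^sub>o U u\<^sub>n w\<^sub>n U\<^sub>n \<and>
           (\<forall>v z Z. scheme_step \<Omega> (fe_space \<Omega> \<T> k) \<epsilon> \<Delta>t (H_fun F F' B) M u\<^sub>o u U\<^sub>o U v z Z \<longrightarrow>
              (\<forall>x\<in>closure \<Omega>. v x = u\<^sub>n x \<and> z x = w\<^sub>n x \<and> Z x = U\<^sub>n x)))) \<and>
     (\<forall>(u :: int \<Rightarrow> 'a \<Rightarrow> real) (w :: int \<Rightarrow> 'a \<Rightarrow> real) (U :: int \<Rightarrow> 'a \<Rightarrow> real) (N :: int).
        (\<forall>x\<in>closure \<Omega>. u (-1) x = L2_proj \<Omega> (fe_space \<Omega> \<T> k) u\<^sub>0 x \<and>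
                        u 0 x = L2_proj \<Omega> (fe_space \<Omega> \<T> k) u\<^sub>0 x \<and>
                        U (-1) x = sqrt (F (u\<^sub>0 x) + B) \<and> U 0 x = sqrt (F (u\<^sub>0 x) + B)) \<and>
        (\<forall>n. 0 \<le> n \<and> n < N \<longrightarrow>
           (\<forall>x\<in>closure \<Omega>. extrap (u (n - 1)) (u n) x \<in> admissible_values I J F B) \<and>
           scheme_step \<Omega> (fe_space \<Omega> \<T> k) \<epsilon> \<Delta>t (H_fun F F' B) M
             (u (n - 1)) (u n) (U (n - 1)) (U n) (u (n + 1)) (w (n + 1)) (U (n + 1))) \<longrightarrow>
        (\<forall>n. 0 < n \<and> n \<le> N \<longrightarrow>
           (LINT x|lebesgue_on \<Omega>. u n x) = (LINT x|lebesgue_on \<Omega>. u 0 x)) \<and>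
        (\<forall>n. 0 \<le> n \<and> n < N \<longrightarrow>
           mean_energy \<Omega> \<epsilon> B u U (n + 1) =
             mean_energy \<Omega> \<epsilon> B u U n
             - \<Delta>t * A_form \<Omega> (\<lambda>x. M (extrap (u (n - 1)) (u n) x)) (w (n + 1)) (w (n + 1))
             - 1/4 * A_form \<Omega> (\<lambda>_. \<epsilon>\<^sup>2)
                 (\<lambda>x. u (n + 1) x - extrap (u (n - 1)) (u n) x)
                 (\<lambda>x. u (n + 1) x - extrap (u (n - 1)) (u n) x)
             - 1/2 * (L2_norm \<Omega> (\<lambda>x. U (n + 1) x - extrap (U (n - 1)) (U n) x))\<^sup>2))"
proof -
  let ?V = "fe_space \<Omega> \<T> k"
  have \<Omega>: "open \<Omega>" "bounded \<Omega>" using domain by auto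
  have \<T>: "finite \<T>" "\<Union>\<T> = closure \<Omega>"
    using mesh(2) by (auto simp: quasi_uniform_triangulation_def triangulation_def)
  have V: "fun_space ?V" by (rule fe_space_fun_space[OF \<Omega> \<T>(2)])
  have solvable: "\<exists>u\<^sub>n w\<^sub>n U\<^sub>n. scheme_step \<Omega> ?V \<epsilon> \<Delta>t (H_fun F F' B) M u\<^sub>o u U\<^sub>o U u\<^sub>n w\<^sub>n U\<^sub>n \<and>
      (\<forall>v z Z. scheme_step \<Omega> ?V \<epsilon> \<Delta>t (H_fun F F' B) M u\<^sub>o u U\<^sub>o U v z Z \<longrightarrow>
        (\<forall>x\<in>closure \<Omega>. v x = u\<^sub>n x \<and> z x = w\<^sub>n x \<and> Z x = U\<^sub>n x))"
    if old: "u\<^sub>o \<in> ?V" "u \<in> ?V" "U\<^sub>o \<in> C0 \<Omega>" "U \<in> C0 \<Omega>"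
      and adm: "\<forall>x\<in>closure \<Omega>. extrap u\<^sub>o u x \<in> admissible_values I J F B" for u\<^sub>o u U\<^sub>o U
  proof (rule scheme_step_unique_solution[OF \<Omega> \<T> dt old])
    have "extrap u\<^sub>o u \<in> C0 \<Omega>" using extrap_in[OF V old(1,2)] fe_space_sub(2) by blast
    then have ex: "continuous_on (closure \<Omega>) (extrap u\<^sub>o u)" by (simp add: C0_def)
    have img: "extrap u\<^sub>o u ` closure \<Omega> \<subseteq> admissible_values I J F B" using adm by blast
    show "(\<lambda>x. H_fun F F' B (extrap u\<^sub>o u x)) \<in> C0 \<Omega>"
      unfolding C0_def mem_Collect_eq
      by (rule continuous_on_compose2[OF H_fun_continuous[OF potential(2,3)] ex img])
    have J: "extrap u\<^sub>o u ` closure \<Omega> \<subseteq> J" using img by (auto simp: admissible_values_def)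
    show "(\<lambda>x. M (extrap u\<^sub>o u x)) \<in> C0 \<Omega>"
      unfolding C0_def mem_Collect_eq by (rule continuous_on_compose2[OF mobility(1) ex J])
    show "M (extrap u\<^sub>o u x) \<ge> 0" if "x \<in> closure \<Omega>" for x
      using mobility(2) J that by blast
  qed
  have run: "(\<forall>n. 0 < n \<and> n \<le> N \<longrightarrow> (LINT x|lebesgue_on \<Omega>. u n x) = (LINT x|lebesgue_on \<Omega>. u 0 x)) \<and>
      (\<forall>n. 0 \<le> n \<and> n < N \<longrightarrow> mean_energy \<Omega> \<epsilon> B u U (n + 1) = mean_energy \<Omega> \<epsilon> B u U n
        - \<Delta>t * A_form \<Omega> (\<lambda>x. M (extrap (u (n - 1)) (u n) x)) (w (n + 1)) (w (n + 1))
        - 1/4 * A_form \<Omega> (\<lambda>_. \<epsilon>\<^sup>2) (\<lambda>x. u (n + 1) x - extrap (u (n - 1)) (u n) x)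
            (\<lambda>x. u (n + 1) x - extrap (u (n - 1)) (u n) x)
        - 1/2 * (L2_norm \<Omega> (\<lambda>x. U (n + 1) x - extrap (U (n - 1)) (U n) x))\<^sup>2)"
    if init: "\<forall>x\<in>closure \<Omega>. u (-1) x = L2_proj \<Omega> ?V u\<^sub>0 x \<and> u 0 x = L2_proj \<Omega> ?V u\<^sub>0 x \<and>
        U (-1) x = sqrt (F (u\<^sub>0 x) + B) \<and> U 0 x = sqrt (F (u\<^sub>0 x) + B)"
      and steps: "\<forall>n. 0 \<le> n \<and> n < N \<longrightarrow>
        (\<forall>x\<in>closure \<Omega>. extrap (u (n - 1)) (u n) x \<in> admissible_values I J F B) \<and>
        scheme_step \<Omega> ?V \<epsilon> \<Delta>t (H_fun F F' B) M
          (u (n - 1)) (u n) (U (n - 1)) (U n) (u (n + 1)) (w (n + 1)) (U (n + 1))"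
    for u w U :: "int \<Rightarrow> 'a \<Rightarrow> real" and N :: int
  proof -
    have step: "scheme_step \<Omega> ?V \<epsilon> \<Delta>t (H_fun F F' B) M
        (u (n - 1)) (u n) (U (n - 1)) (U n) (u (n + 1)) (w (n + 1)) (U (n + 1))"
      if "0 \<le> n" "n < N" for n
      using steps that by blast
    have "u (-1) \<in> ?V" "u 0 \<in> ?V"
      by (rule fe_space_cong[OF \<Omega> \<T>(2) L2_proj_mem[OF \<Omega> \<T> datum(1)]]; use init in blast)+
    moreover have "U (-1) \<in> C0 \<Omega>" "U 0 \<in> C0 \<Omega>"
      by (rule C0_cong[OF _ datum(3)]; use init in simp)+
    moreover have "u n \<in> ?V \<and> U n \<in> C0 \<Omega>" if "0 < n" "n \<le> N" for n
      using step[of "n - 1"] that by (simp add: scheme_step_def)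
    ultimately have mem: "u n \<in> ?V \<and> U n \<in> C0 \<Omega>" if "-1 \<le> n" "n \<le> N" for n
      using that by (cases "n = -1 \<or> n = 0") auto
    let ?m = "\<lambda>n. LINT x|lebesgue_on \<Omega>. u n x"
    \<comment> \<open>The two-step recursion for the mass starts from two equal values because \<open>u (-1)\<close> and \<open>u 0\<close> agree.\<close>
    have "?m (-1) = ?m 0"
      using init closure_subset[of \<Omega>]
      by (intro Bochner_Integration.integral_cong) (auto simp: space_restrict_space)
    then have mass: "int j \<le> N \<longrightarrow> ?m (int j) = ?m 0 \<and> ?m (int j - 1) = ?m 0" for j
    proof (induction j)
      case (Suc j)
      show ?case
      proof
        assume j: "int (Suc j) \<le> N"
        have "3 * ?m (int j + 1) = 4 * ?m (int j) - ?m (int j - 1)"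
          by (rule scheme_step_mass[OF \<Omega> fe_space_const[OF \<Omega>] fe_space_sub(2) dt _ _ step[of "int j"]])
            (use mem j in auto)
        then show "?m (int (Suc j)) = ?m 0 \<and> ?m (int (Suc j) - 1) = ?m 0"
          using Suc j by (simp add: add.commute)
      qed
    qed simp
    have "?m n = ?m 0" if "0 < n" "n \<le> N" for n
      using mass[of "nat n"] that by simp
    moreover have "mean_energy \<Omega> \<epsilon> B u U (n + 1) = mean_energy \<Omega> \<epsilon> B u U n
        - \<Delta>t * A_form \<Omega> (\<lambda>x. M (extrap (u (n - 1)) (u n) x)) (w (n + 1)) (w (n + 1))
        - 1/4 * A_form \<Omega> (\<lambda>_. \<epsilon>\<^sup>2) (\<lambda>x. u (n + 1) x - extrap (u (n - 1)) (u n) x)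
            (\<lambda>x. u (n + 1) x - extrap (u (n - 1)) (u n) x)
        - 1/2 * (L2_norm \<Omega> (\<lambda>x. U (n + 1) x - extrap (U (n - 1)) (U n) x))\<^sup>2"
      if n: "0 \<le> n" "n < N" for n
      using scheme_step_energy[OF \<Omega> V fe_space_sub(2,1) dt _ _ _ _ step[OF n], of B]
        mem[of "n - 1"] mem[of n] n by (simp add: mean_energy_def)
    ultimately show ?thesis by blast
  qed
  show ?thesis
  proof (intro conjI allI ballI impI)
    fix u\<^sub>o u U\<^sub>o U
    assume "u\<^sub>o \<in> ?V" "u \<in> ?V" "U\<^sub>o \<in> C0 \<Omega>" "U \<in> C0 \<Omega>"
      and "\<forall>x\<in>closure \<Omega>. extrap u\<^sub>o u x \<in> admissible_values I J F B"
    then show "\<exists>u\<^sub>n w\<^sub>n U\<^sub>n. scheme_step \<Omega> ?V \<epsilon> \<Delta>t (H_fun F F' B) M u\<^sub>o u U\<^sub>o U u\<^sub>n w\<^sub>n U\<^sub>n \<and>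
        (\<forall>v z Z. scheme_step \<Omega> ?V \<epsilon> \<Delta>t (H_fun F F' B) M u\<^sub>o u U\<^sub>o U v z Z \<longrightarrow>
          (\<forall>x\<in>closure \<Omega>. v x = u\<^sub>n x \<and> z x = w\<^sub>n x \<and> Z x = U\<^sub>n x))"
      by (rule solvable)
  qed (use run in blast)+
qed

end
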